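(* Let $a>0$, let $\alpha$ be real with $0<|\alpha|<1$, and let $f$ and $g$ be suitably smooth functions on $[0,a]$, independent of $w$, with $g$ real-valued, $g(0)=0$ and $g'(x)>0$ for $x\in[0,a]$. Let $0=x_0<x_1<\cdots<x_n=a$ be nodes with multiplicities $m_0,\ldots,m_n\ge 1$, where $m_0=m_n=s+1$ for an integer $s\ge 0$, and let $M=\sum_{j=0}^n m_j-1$. Let $\{\phi_j\}_{j=1}^M$ be a Chebyshev set of functions on $[0,a]$ independent of $w$. Then for all sufficiently large $w$ the linear system $$ \frac{d^{j}\mathcal{W}[c_0,q_1]}{dx^j}(x_l)=f_1^{(j)}(x_l),\qquad j=0,1,\ldots,m_l-1,\quad l=0,1,\ldots,n, $$ for the unknowns $c_0,c_1,\ldots,c_M$, where $q_1=\sum_{j=1}^M c_j\phi_j$, has a unique solution, and, as $w\to\infty$, $$ \int_0^a f(x)x^\alpha e^{iwg(x)}\,dx-Q_{w,\alpha,n}^{L,s}[f]=\mathcal{O}\bigl(w^{-s-1-\min\{1+\alpha,1\}}\bigr). $$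
   Context: "Suitably smooth" means having as many continuous derivatives on $[0,a]$ as needed (it may be read as $C^\infty[0,a]$); the same applies to the basis functions $\phi_j$. "Chebyshev set" is understood in the sense that counts multiplicity: every nontrivial linear combination of $\phi_1,\ldots,\phi_M$ has at most $M-1$ zeros in $[0,a]$ counted with multiplicity (equivalently, every Hermite interpolation problem with $M$ conditions has a unique solution in the span). Definitions. The function $f_1$ is $f_1(x)=f(x)\left(\frac{x}{g(x)}\right)^\alpha$ for $x\ne0$ and $f_1(0)=\frac{f(0)}{(g'(0))^\alpha}$. For a number $c_0$ and a function $q_1$, $$\mathcal{W}[c_0,q_1](x)=iwg'(x)c_0+g(x)q_1'(x)+[1+\alpha+iwg(x)]g'(x)q_1(x).$$ With $(c_0,q_1)$ obtained from the linear system in the claim, set $$h(x)=\alpha c_0e^{-iwg(x)}\int_0^x\frac{g'(t)\,(1-e^{iwg(t)})}{g^{1-\alpha}(t)}\,dt,$$ and define the Levin method $$Q_{w,\alpha,n}^{L,s}[f]=\left.\left[g^{\alpha+1}(x)q_1(x)+c_0(1-e^{-iwg(x)})g^\alpha(x)+h(x)\right]e^{iwg(x)}\right|_0^a,$$ where the value at $x=0$ is understood as the limit $x\to0^+$ (which is $0$). Here $s=\min(m_0,m_n)-1$. *)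

theory Defs
  imports "HOL-Analysis.Analysis" "HOL-Library.Landau_Symbols" "HOL-Library.Extended_Nat"
begin

text \<open>Derivatives are taken relative to the closed interval, hence are one-sided at its endpoints;
  nothing depends on the values of a function outside the interval.\<close>

definition nderiv :: "real set \<Rightarrow> nat \<Rightarrow> (real \<Rightarrow> 'a::real_normed_vector) \<Rightarrow> real \<Rightarrow> 'a" where
  "nderiv S k f = ((\<lambda>u x. vector_derivative u (at x within S)) ^^ k) f"

definition smooth_within :: "real set \<Rightarrow> (real \<Rightarrow> 'a::real_normed_vector) \<Rightarrow> bool" where
  "smooth_within S f \<longleftrightarrow> (\<forall>k. \<forall>x\<in>S. nderiv S k f differentiable (at x within S))"

text \<open>The multiplicity is 0 if \<open>u x \<noteq> 0\<close>, and \<open>\<infinity>\<close> if all derivatives of \<open>u\<close> vanish at \<open>x\<close>.\<close>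

definition zero_mult :: "real set \<Rightarrow> (real \<Rightarrow> complex) \<Rightarrow> real \<Rightarrow> enat" where
  "zero_mult S u x = Sup {enat k |k. \<forall>j<k. nderiv S j u x = 0}"

definition lin_comb :: "nat \<Rightarrow> (nat \<Rightarrow> real \<Rightarrow> complex) \<Rightarrow> (nat \<Rightarrow> complex) \<Rightarrow> real \<Rightarrow> complex" where
  "lin_comb M \<phi> c x = (\<Sum>j=1..M. c j * \<phi> j x)"

definition chebyshev_set :: "real set \<Rightarrow> nat \<Rightarrow> (nat \<Rightarrow> real \<Rightarrow> complex) \<Rightarrow> bool" where
  "chebyshev_set S M \<phi> \<longleftrightarrow>
     (\<forall>c. (\<exists>j\<in>{1..M}. c j \<noteq> 0) \<longrightarrow>
        (let u = lin_comb M \<phi> c; Z = {x\<in>S. u x = 0}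
         in finite Z \<and> (\<Sum>x\<in>Z. zero_mult S u x) \<le> enat (M - 1)))"

definition f1 :: "real \<Rightarrow> real \<Rightarrow> (real \<Rightarrow> complex) \<Rightarrow> (real \<Rightarrow> real) \<Rightarrow> real \<Rightarrow> complex" where
  "f1 a \<alpha> f g x =
     (if x = 0 then f 0 / complex_of_real ((nderiv {0..a} 1 g 0) powr \<alpha>)
      else f x * complex_of_real ((x / g x) powr \<alpha>))"

definition levin_op ::
  "real \<Rightarrow> real \<Rightarrow> (real \<Rightarrow> real) \<Rightarrow> real \<Rightarrow> complex \<Rightarrow> (real \<Rightarrow> complex) \<Rightarrow> real \<Rightarrow> complex" where
  "levin_op a \<alpha> g w c0 q x =
     (let g' = nderiv {0..a} 1 g x
      in \<i> * of_real w * of_real g' * c0 + of_real (g x) * nderiv {0..a} 1 q x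
         + (1 + of_real \<alpha> + \<i> * of_real w * of_real (g x)) * of_real g' * q x)"

definition levin_system ::
  "real \<Rightarrow> real \<Rightarrow> (real \<Rightarrow> complex) \<Rightarrow> (real \<Rightarrow> real) \<Rightarrow> nat \<Rightarrow> (nat \<Rightarrow> real) \<Rightarrow> (nat \<Rightarrow> nat)
   \<Rightarrow> nat \<Rightarrow> (nat \<Rightarrow> real \<Rightarrow> complex) \<Rightarrow> real \<Rightarrow> (nat \<Rightarrow> complex) \<Rightarrow> bool" where
  "levin_system a \<alpha> f g n x m M \<phi> w c \<longleftrightarrow>
     (\<forall>l\<le>n. \<forall>j<m l.
        nderiv {0..a} j (levin_op a \<alpha> g w (c 0) (lin_comb M \<phi> c)) (x l)
        = nderiv {0..a} j (f1 a \<alpha> f g) (x l))"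

text \<open>The vector \<open>(c 0, \<dots>, c M)\<close> is a function on \<open>{0..M}\<close>, extended by \<open>undefined\<close>, so that
  uniqueness of the vector is uniqueness of the function.\<close>

definition levin_coeffs ::
  "real \<Rightarrow> real \<Rightarrow> (real \<Rightarrow> complex) \<Rightarrow> (real \<Rightarrow> real) \<Rightarrow> nat \<Rightarrow> (nat \<Rightarrow> real) \<Rightarrow> (nat \<Rightarrow> nat)
   \<Rightarrow> nat \<Rightarrow> (nat \<Rightarrow> real \<Rightarrow> complex) \<Rightarrow> real \<Rightarrow> nat \<Rightarrow> complex" where
  "levin_coeffs a \<alpha> f g n x m M \<phi> w =
     (THE c. c \<in> {0..M} \<rightarrow>\<^sub>E UNIV \<and> levin_system a \<alpha> f g n x m M \<phi> w c)"

text \<open>The integrand is singular at \<open>t = 0\<close>, where its formal value is irrelevant.\<close>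

definition levin_h :: "real \<Rightarrow> real \<Rightarrow> (real \<Rightarrow> real) \<Rightarrow> real \<Rightarrow> complex \<Rightarrow> real \<Rightarrow> complex" where
  "levin_h a \<alpha> g w c0 x =
     of_real \<alpha> * c0 * exp (- \<i> * of_real w * of_real (g x)) *
     integral {0..x} (\<lambda>t. of_real (nderiv {0..a} 1 g t) * (1 - exp (\<i> * of_real w * of_real (g t)))
                          / of_real (g t powr (1 - \<alpha>)))"

definition levin_antideriv ::
  "real \<Rightarrow> real \<Rightarrow> (real \<Rightarrow> real) \<Rightarrow> real \<Rightarrow> complex \<Rightarrow> (real \<Rightarrow> complex) \<Rightarrow> real \<Rightarrow> complex" where
  "levin_antideriv a \<alpha> g w c0 q x =
     (of_real (g x powr (\<alpha> + 1)) * q x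
      + c0 * (1 - exp (- \<i> * of_real w * of_real (g x))) * of_real (g x powr \<alpha>)
      + levin_h a \<alpha> g w c0 x) * exp (\<i> * of_real w * of_real (g x))"

text \<open>For negative \<open>\<alpha>\<close> the factor \<open>g x powr \<alpha>\<close> is singular at 0, so the lower boundary value is
  the limit from the right.\<close>

definition levin_Q ::
  "real \<Rightarrow> real \<Rightarrow> (real \<Rightarrow> complex) \<Rightarrow> (real \<Rightarrow> real) \<Rightarrow> nat \<Rightarrow> (nat \<Rightarrow> real) \<Rightarrow> (nat \<Rightarrow> nat)
   \<Rightarrow> nat \<Rightarrow> (nat \<Rightarrow> real \<Rightarrow> complex) \<Rightarrow> real \<Rightarrow> complex" where
  "levin_Q a \<alpha> f g n x m M \<phi> w =
     (let c = levin_coeffs a \<alpha> f g n x m M \<phi> w;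
          F = levin_antideriv a \<alpha> g w (c 0) (lin_comb M \<phi> c)
      in F a - Lim (at_right 0) F)"

end

theory Submission
  imports Defs "Jordan_Normal_Form.Determinant"
begin

text \<open>
  The function F = g^(\<alpha>+1) q e^(iwg) + iwc_0 \<integral>_0^x g^\<alpha> g' e^(iwg) is a primitive of
  g^\<alpha> W[c_0,q] e^(iwg), is continuous on [0,a] and vanishes at 0. The antiderivative that
  defines the Levin method is F in another form: integration by parts in the integral behind h
  makes the singular terms cancel. So the error of the method is the oscillatory integral
  \<integral>_0^a g^\<alpha> \<rho> g' e^(iwg) with \<rho> = (f_1 - W[c_0,q_1]) / g', and by collocation \<rho>
  vanishes to order s+1 at both endpoints.

  The coefficients are small. Divided by w, the system tends to the collocation of
  i g' (c_0 + g q) with right-hand side 0. If that function has zeros of multiplicity m_l at all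
  nodes, then c_0 = 0 because g(0) = 0, and q has zeros of multiplicity s at 0 (one is lost to the
  simple zero of g) and m_l at the other nodes: M zeros in total, so q = 0 by the Chebyshev
  property (\<open>limit_system_injective\<close>). Hence the limit matrix is invertible, the system is uniquely
  solvable for large w, and c_k = O(1/w) (\<open>square_system_with_large_parameter\<close>). So \<rho> is a
  combination, with coefficients bounded in w, of finitely many smooth functions that do not
  depend on w.

  Integration by parts with boundary values \<rho>(0) = \<rho>(a) = 0 replaces \<rho> by
  -(\<alpha> \<rho>/g + \<rho>'/g') / (iw). If \<rho>/g is read as (\<rho> - \<rho>(0))/g, then this is a linear
  operator on all smooth functions, by Hadamard's division lemma; it lowers the order
  of vanishing by one. After s+1 steps the integrand is a bounded combination of fixed smooth functions,
  and for each of these a splitting at the point where g = 1/w gives the remaining factor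
  O(w^(-min(1+\<alpha>,1))) (\<open>osc_integral_decay\<close>, \<open>vanishing_combination_decay\<close>). Linearity is
  what makes the estimate uniform in w.
\<close>

section \<open>Square linear systems with a large parameter\<close>

lemma square_injective_imp_inverse:
  fixes B :: "nat \<Rightarrow> nat \<Rightarrow> complex"
  assumes inj: "\<forall>c. (\<forall>i<N. (\<Sum>k<N. B i k * c k) = 0) \<longrightarrow> (\<forall>k<N. c k = 0)"
  shows "\<exists>L. (\<forall>i<N. \<forall>j<N. (\<Sum>k<N. L i k * B k j) = (if i = j then 1 else 0)) \<and>
             (\<forall>i<N. \<forall>j<N. (\<Sum>k<N. B i k * L k j) = (if i = j then 1 else 0))"
proof -
  define A where "A = mat N N (\<lambda>(i, j). B i j)"
  have A: "A \<in> carrier_mat N N"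
    by (simp add: A_def)
  have "det A \<noteq> 0"
  proof
    assume "det A = 0"
    then obtain v where v: "v \<in> carrier_vec N" "v \<noteq> 0\<^sub>v N" "A *\<^sub>v v = 0\<^sub>v N"
      using det_0_iff_vec_prod_zero_field[OF A] by auto
    have "(\<Sum>k<N. B i k * vec_index v k) = 0" if "i < N" for i
    proof -
      have "vec_index (A *\<^sub>v v) i = (\<Sum>k<N. B i k * vec_index v k)"
        using that v(1) by (simp add: A_def scalar_prod_def row_def atLeast0LessThan)
      then show ?thesis
        using that v(3) by simp
    qed
    then have "\<And>k. k < N \<Longrightarrow> vec_index v k = 0"
      using inj by blast
    then have "v = 0\<^sub>v N"
      using v(1) by (intro eq_vecI) auto
    with v(2) show False by contradiction
  qed
  from det_non_zero_imp_unit[OF A this, unfolded Units_def, of "()"]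
  obtain X where X: "X \<in> carrier_mat N N" and XA: "X * A = 1\<^sub>m N" and AX: "A * X = 1\<^sub>m N"
    by (auto simp: ring_mat_def)
  show ?thesis
  proof (intro exI conjI allI impI)
    fix i j assume ij: "i < N" "j < N"
    have "index_mat (X * A) (i, j) = (\<Sum>k<N. index_mat X (i, k) * B k j)"
      using ij X by (simp add: A_def scalar_prod_def row_def col_def atLeast0LessThan)
    then show "(\<Sum>k<N. index_mat X (i, k) * B k j) = (if i = j then 1 else 0)"
      using ij XA by simp
  next
    fix i j assume ij: "i < N" "j < N"
    have "index_mat (A * X) (i, j) = (\<Sum>k<N. B i k * index_mat X (k, j))"
      using ij X by (simp add: A_def scalar_prod_def row_def col_def atLeast0LessThan)
    then show "(\<Sum>k<N. B i k * index_mat X (k, j)) = (if i = j then 1 else 0)"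
      using ij AX by simp
  qed
qed

text \<open>A left inverse L of B turns (wB + D)c = b into wc + LDc = Lb. Looking at the entry of c of maximal
modulus gives (w - K) |c| \<le> \<beta>(b), where K bounds LD and \<beta>(b) bounds Lb. For w > 2K this is
the asserted bound, and for b = 0 it is injectivity of wB + D, from which solvability follows
since the system is square.\<close>

lemma square_system_with_large_parameter:
  fixes B D :: "nat \<Rightarrow> nat \<Rightarrow> complex" and b :: "nat \<Rightarrow> complex" and N :: nat
  defines "sys \<equiv> (\<lambda>w b c. \<forall>i<N. (\<Sum>k<N. (of_real w * B i k + D i k) * c k) = b i)"
  assumes inj: "\<forall>c. (\<forall>i<N. (\<Sum>k<N. B i k * c k) = 0) \<longrightarrow> (\<forall>k<N. c k = 0)"
  shows "\<exists>C\<ge>0. \<forall>\<^sub>F w in at_top. (\<exists>c. sys w b c) \<and>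
           (\<forall>c c'. sys w b c \<longrightarrow> sys w b c' \<longrightarrow> (\<forall>k<N. c k = c' k)) \<and>
           (\<forall>c. sys w b c \<longrightarrow> (\<forall>k<N. cmod (of_real w * c k) \<le> C))"
proof -
  obtain L where L: "\<forall>i<N. \<forall>j<N. (\<Sum>k<N. L i k * B k j) = (if i = j then 1 else 0)"
    using square_injective_imp_inverse[OF inj] by blast
  define E where "E = (\<lambda>i k. \<Sum>l<N. L i l * D l k)"
  define \<beta> where "\<beta> = (\<lambda>b. \<Sum>i<N. cmod (\<Sum>l<N. L i l * b l))"
  define K where "K = (\<Sum>i<N. \<Sum>k<N. cmod (E i k))"
  have K0: "K \<ge> 0" by (simp add: K_def sum_nonneg)
  have \<beta>0: "\<beta> b \<ge> 0" for b by (simp add: \<beta>_def sum_nonneg)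
  have est: "(w - K) * cmod (c i) \<le> \<beta> b"
    if s: "sys w b c" and i: "i < N" and w: "w > K" for w b c i
  proof -
    \<comment> \<open>the sup norm of c, attained at the index \<open>p\<close> below\<close>
    define T where "T = (MAX k\<in>{..<N}. cmod (c k))"
    have ne: "finite {..<N}" "{..<N} \<noteq> {}" using i by auto
    have le: "cmod (c k) \<le> T" if "k < N" for k
      unfolding T_def using that by (intro Max_ge) auto
    have "T \<in> (\<lambda>k. cmod (c k)) ` {..<N}"
      unfolding T_def using ne by (intro Max_in) auto
    then obtain p where p: "p < N" "T = cmod (c p)" by auto
    have "(\<Sum>l<N. L p l * b l) = (\<Sum>l<N. L p l * (\<Sum>k<N. (of_real w * B l k + D l k) * c k))"
      using s by (simp add: sys_def)
    also have "\<dots> = (\<Sum>k<N. of_real w * (\<Sum>l<N. L p l * B l k) * c k + E p k * c k)"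
      unfolding E_def sum_distrib_left sum_distrib_right sum.distrib[symmetric]
      by (subst sum.swap) (simp add: algebra_simps)
    also have "\<dots> = (\<Sum>k<N. (if p = k then of_real w * c k else 0) + E p k * c k)"
      using p(1) by (intro sum.cong) (auto simp: L)
    also have "\<dots> = of_real w * c p + (\<Sum>k<N. E p k * c k)"
      using p(1) by (simp add: sum.distrib)
    finally have "of_real w * c p = (\<Sum>l<N. L p l * b l) - (\<Sum>k<N. E p k * c k)"
      by simp
    then have "cmod (of_real w * c p) \<le> cmod (\<Sum>l<N. L p l * b l) + cmod (\<Sum>k<N. E p k * c k)"
      by (simp add: norm_triangle_ineq4)
    also have "cmod (\<Sum>l<N. L p l * b l) \<le> \<beta> b"
      unfolding \<beta>_def using p(1) by (intro member_le_sum) auto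
    also have "cmod (\<Sum>k<N. E p k * c k) \<le> (\<Sum>k<N. cmod (E p k)) * T"
      unfolding sum_distrib_right
      by (rule order.trans[OF norm_sum]) (auto simp: norm_mult intro!: sum_mono mult_left_mono le)
    also have "\<dots> \<le> K * T"
      unfolding K_def using p
      by (intro mult_right_mono member_le_sum[of p "{..<N}" "\<lambda>i. \<Sum>k<N. cmod (E i k)"])
        (auto simp: sum_nonneg)
    finally have "w * T \<le> \<beta> b + K * T"
      using w K0 p(2) by (simp add: norm_mult)
    then have "(w - K) * T \<le> \<beta> b" by (simp add: algebra_simps)
    moreover have "(w - K) * cmod (c i) \<le> (w - K) * T"
      using le[OF i] w by (intro mult_left_mono) auto
    ultimately show ?thesis by linarith
  qed
  have main: "(\<exists>c. sys w b c) \<and>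
           (\<forall>c c'. sys w b c \<longrightarrow> sys w b c' \<longrightarrow> (\<forall>k<N. c k = c' k)) \<and>
           (\<forall>c. sys w b c \<longrightarrow> (\<forall>k<N. cmod (of_real w * c k) \<le> 2 * \<beta> b))" if w: "w > 2 * K" for w
  proof -
    have wK: "w > K" "w > 0" using w K0 by auto
    have hom: "c k = 0" if "sys w (\<lambda>_. 0) c" "k < N" for c k
    proof -
      have "(w - K) * cmod (c k) \<le> 0"
        using est[OF that wK(1)] by (simp add: \<beta>_def)
      then show ?thesis using wK by (simp add: mult_le_0_iff)
    qed
    have inj': "\<forall>c. (\<forall>i<N. (\<Sum>k<N. (of_real w * B i k + D i k) * c k) = 0) \<longrightarrow> (\<forall>k<N. c k = 0)"
      using hom by (simp add: sys_def)
    obtain X where X: "\<forall>i<N. \<forall>j<N.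
        (\<Sum>k<N. (of_real w * B i k + D i k) * X k j) = (if i = j then 1 else 0)"
      using square_injective_imp_inverse[OF inj'] by blast
    have "sys w b (\<lambda>k. \<Sum>j<N. X k j * b j)"
      unfolding sys_def
    proof (intro allI impI)
      fix i assume i: "i < N"
      have "(\<Sum>k<N. (of_real w * B i k + D i k) * (\<Sum>j<N. X k j * b j))
          = (\<Sum>j<N. (\<Sum>k<N. (of_real w * B i k + D i k) * X k j) * b j)"
        unfolding sum_distrib_left sum_distrib_right by (subst sum.swap) (simp add: algebra_simps)
      also have "\<dots> = (\<Sum>j<N. if i = j then b j else 0)"
        using i by (intro sum.cong) (auto simp: X)
      finally show "(\<Sum>k<N. (of_real w * B i k + D i k) * (\<Sum>j<N. X k j * b j)) = b i"
        using i by simp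
    qed
    moreover have "c k = c' k" if "sys w b c" "sys w b c'" "k < N" for c c' k
    proof -
      have "sys w (\<lambda>_. 0) (\<lambda>k. c k - c' k)"
        using that by (simp add: sys_def right_diff_distrib sum_subtractf)
      from hom[OF this that(3)] show ?thesis by simp
    qed
    moreover have "cmod (of_real w * c k) \<le> 2 * \<beta> b" if "sys w b c" "k < N" for c k
    proof -
      have "w * cmod (c k) \<le> (2 * (w - K)) * cmod (c k)"
        using w by (intro mult_right_mono) auto
      also have "\<dots> = 2 * ((w - K) * cmod (c k))" by simp
      also have "\<dots> \<le> 2 * \<beta> b" using est[OF that wK(1)] by simp
      finally show ?thesis using wK by (simp add: norm_mult)
    qed
    ultimately show ?thesis by blast
  qed
  show ?thesis
    by (intro exI[of _ "2 * \<beta> b"] conjI) (use \<beta>0 main in \<open>auto intro: eventually_mono[OF eventually_gt_at_top[of "2 * K"]]\<close>)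
qed

section \<open>Calculus of smooth functions on a closed interval\<close>

locale initial_interval =
  fixes a :: real
  assumes a_pos: "a > 0"
begin

definition D :: "(real \<Rightarrow> 'a::real_normed_vector) \<Rightarrow> real \<Rightarrow> 'a" where
  "D u = nderiv {0..a} 1 u"

abbreviation smooth :: "(real \<Rightarrow> 'a::real_normed_vector) \<Rightarrow> bool" where
  "smooth \<equiv> smooth_within {0..a}"

text \<open>Closure properties of smooth functions are proved order by order: the derivative of a product,
reciprocal or power contains the function itself again, so an induction needs the statement for
functions that are differentiable only a given number of times.\<close>

definition times_differentiable :: "nat \<Rightarrow> (real \<Rightarrow> 'a::real_normed_vector) \<Rightarrow> bool" where
  "times_differentiable k u \<longleftrightarrow> (\<forall>j<k. \<forall>x\<in>{0..a}. nderiv {0..a} j u differentiable (at x within {0..a}))"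

lemma D_eq: "D u x = vector_derivative u (at x within {0..a})"
  by (simp add: nderiv_def D_def)

lemma nderiv_1 [simp]: "nderiv {0..a} (Suc 0) u = D u"
  by (simp add: D_def)

lemma nderiv_0 [simp]: "nderiv S 0 u = u"
  by (simp add: nderiv_def)

lemma nderiv_Suc: "nderiv {0..a} (Suc k) u = D (nderiv {0..a} k u)"
  by (simp add: nderiv_def D_def)

lemma nderiv_Suc': "nderiv {0..a} (Suc k) u = nderiv {0..a} k (D u)"
  by (simp only: nderiv_def D_def funpow_Suc_right o_def One_nat_def funpow_0 id_apply funpow.simps)

lemma D_unique: "D u x = u'" if "(u has_vector_derivative u') (at x within {0..a})" "x \<in> {0..a}"
  unfolding D_eq using vector_derivative_within_cbox[of 0 a x u u'] a_pos that by simp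

lemma smooth_iff_times_differentiable: "smooth u \<longleftrightarrow> (\<forall>k. times_differentiable k u)"
  by (auto simp: smooth_within_def times_differentiable_def)

lemma times_differentiable_0 [simp]: "times_differentiable 0 u"
  by (simp add: times_differentiable_def)

lemma times_differentiable_Suc:
  "times_differentiable (Suc k) u \<longleftrightarrow>
     (\<forall>x\<in>{0..a}. u differentiable (at x within {0..a})) \<and> times_differentiable k (D u)"
  unfolding times_differentiable_def
  by (auto simp: nderiv_Suc' less_Suc_eq_0_disj)

lemma times_differentiable_mono: "times_differentiable k u" if "times_differentiable l u" "k \<le> l"
  using that by (auto simp: times_differentiable_def)

lemma D_cong:
  assumes "\<And>x. x \<in> {0..a} \<Longrightarrow> u x = v x" "x \<in> {0..a}"
  shows "D u x = D v x"
proof -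
  have "(u has_vector_derivative d) (at x within {0..a}) \<longleftrightarrow>
        (v has_vector_derivative d) (at x within {0..a})" for d
    using has_vector_derivative_transform[of x "{0..a}" u v d]
      has_vector_derivative_transform[of x "{0..a}" v u d] assms by auto
  then show ?thesis by (simp add: D_eq vector_derivative_def)
qed

lemma nderiv_cong:
  assumes "\<And>x. x \<in> {0..a} \<Longrightarrow> u x = v x" "x \<in> {0..a}"
  shows "nderiv {0..a} k u x = nderiv {0..a} k v x"
  using assms(2)
proof (induction k arbitrary: x)
  case (Suc k)
  then show ?case using D_cong[of "nderiv {0..a} k u" "nderiv {0..a} k v" x] by (simp add: nderiv_Suc)
qed (use assms in simp)

lemma differentiable_cong:
  assumes "\<And>x. x \<in> {0..a} \<Longrightarrow> u x = v x" "x \<in> {0..a}"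
  shows "u differentiable (at x within {0..a}) \<longleftrightarrow> v differentiable (at x within {0..a})"
  unfolding differentiable_def
  using has_derivative_transform[of x "{0..a}" u v] has_derivative_transform[of x "{0..a}" v u] assms
  by metis

lemma times_differentiable_cong:
  assumes "\<And>x. x \<in> {0..a} \<Longrightarrow> u x = v x"
  shows "times_differentiable k u \<longleftrightarrow> times_differentiable k v"
  using differentiable_cong[OF nderiv_cong[OF assms]] by (simp add: times_differentiable_def)

lemma smooth_cong:
  assumes "\<And>x. x \<in> {0..a} \<Longrightarrow> u x = v x"
  shows "smooth u \<longleftrightarrow> smooth v"
  using times_differentiable_cong[OF assms] by (simp add: smooth_iff_times_differentiable)

text \<open>The tool for all closure properties: any u' that is the derivative on the interval may stand for the
chosen one, since derivatives outside the interval do not matter.\<close>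

lemma times_differentiable_SucI:
  assumes "\<And>x. x \<in> {0..a} \<Longrightarrow> (u has_vector_derivative u' x) (at x within {0..a})"
    and "times_differentiable k u'"
  shows "times_differentiable (Suc k) u"
  unfolding times_differentiable_Suc
proof
  show "\<forall>x\<in>{0..a}. u differentiable (at x within {0..a})"
    by (intro ballI differentiableI_vector) (rule assms(1))
  show "times_differentiable k (D u)"
    using times_differentiable_cong[of "D u" u' k] D_unique[OF assms(1)] assms(2) by simp
qed

lemma times_differentiable_SucD:
  assumes "times_differentiable (Suc k) u"
  shows "times_differentiable k (D u)"
    and "x \<in> {0..a} \<Longrightarrow> (u has_vector_derivative D u x) (at x within {0..a})"
  using assms by (auto simp: times_differentiable_Suc D_eq vector_derivative_works)

lemma smooth_D: "smooth u \<Longrightarrow> smooth (D u)"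
  by (auto simp: smooth_iff_times_differentiable intro: times_differentiable_SucD(1))

lemma smooth_deriv:
  "(u has_vector_derivative D u x) (at x within {0..a})" if "smooth u" "x \<in> {0..a}"
  by (rule times_differentiable_SucD(2)[of 0]) (use that in \<open>auto simp: smooth_iff_times_differentiable\<close>)

lemma smooth_continuous: "continuous_on {0..a} u" if "smooth u"
  by (auto simp: continuous_on_eq_continuous_within
      intro: has_vector_derivative_continuous smooth_deriv[OF that])

lemma smoothI_deriv:
  assumes "\<And>x. x \<in> {0..a} \<Longrightarrow> (u has_vector_derivative u' x) (at x within {0..a})" "smooth u'"
  shows "smooth u"
  unfolding smooth_iff_times_differentiable
proof
  fix k show "times_differentiable k u"
    by (rule times_differentiable_mono[OF times_differentiable_SucI[OF assms(1), of k]])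
       (use assms(2) in \<open>auto simp: smooth_iff_times_differentiable\<close>)
qed

lemma smooth_const [simp]: "smooth (\<lambda>_. c)"
proof -
  have "times_differentiable k (\<lambda>_. c)" for k and c :: 'a
  proof (induction k arbitrary: c)
    case (Suc k)
    show ?case by (rule times_differentiable_SucI[OF _ Suc[of 0]]) (rule has_vector_derivative_const)
  qed simp
  then show ?thesis by (simp add: smooth_iff_times_differentiable)
qed

lemma smooth_ident: "smooth (\<lambda>x. x)"
  by (rule smoothI_deriv[where u' = "\<lambda>_. 1"]) (auto simp: has_vector_derivative_id)

lemma smooth_bounded_linear:
  assumes T: "bounded_linear T" and u: "smooth u"
  shows "smooth (\<lambda>x. T (u x))"
    and "x \<in> {0..a} \<Longrightarrow> nderiv {0..a} k (\<lambda>x. T (u x)) x = T (nderiv {0..a} k u x)"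
proof -
  have "times_differentiable k (\<lambda>x. T (u x))" if "times_differentiable k u" for k u
    using that
  proof (induction k arbitrary: u)
    case (Suc k)
    show ?case
      by (rule times_differentiable_SucI[OF bounded_linear.has_vector_derivative[OF T]
            Suc.IH[OF times_differentiable_SucD(1)[OF Suc.prems]]])
         (rule times_differentiable_SucD(2)[OF Suc.prems])
  qed simp
  then show "smooth (\<lambda>x. T (u x))" using u by (simp add: smooth_iff_times_differentiable)
  show "nderiv {0..a} k (\<lambda>x. T (u x)) x = T (nderiv {0..a} k u x)" if "x \<in> {0..a}"
    using u that
  proof (induction k arbitrary: u)
    case (Suc k)
    have "D (\<lambda>x. T (u x)) x = T (D u x)" if "x \<in> {0..a}" for x
      by (rule D_unique[OF bounded_linear.has_vector_derivative[OF T smooth_deriv]])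
        (use Suc.prems that in auto)
    then have "nderiv {0..a} (Suc k) (\<lambda>x. T (u x)) x = nderiv {0..a} k (\<lambda>x. T (D u x)) x"
      unfolding nderiv_Suc' by (intro nderiv_cong) (use Suc.prems in auto)
    also have "\<dots> = T (nderiv {0..a} (Suc k) u x)"
      unfolding nderiv_Suc' by (rule Suc.IH) (use Suc.prems smooth_D in auto)
    finally show ?case .
  qed simp
qed

lemma D_add: "D (\<lambda>x. u x + v x) x = D u x + D v x" if "smooth u" "smooth v" "x \<in> {0..a}"
  by (rule D_unique[OF has_vector_derivative_add[OF smooth_deriv smooth_deriv]]) (use that in auto)

lemma times_differentiable_add:
  "times_differentiable k (\<lambda>x. u x + v x)" if "times_differentiable k u" "times_differentiable k v"
  using that
proof (induction k arbitrary: u v)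
  case (Suc k)
  show ?case
    by (rule times_differentiable_SucI[OF has_vector_derivative_add Suc.IH])
      (fact Suc.prems[THEN times_differentiable_SucD(1)] Suc.prems[THEN times_differentiable_SucD(2)])+
qed simp

lemma smooth_add [intro]: "smooth (\<lambda>x. u x + v x)" if "smooth u" "smooth v"
  using that by (auto simp: smooth_iff_times_differentiable intro: times_differentiable_add)

lemma nderiv_add:
  "nderiv {0..a} k (\<lambda>x. u x + v x) x = nderiv {0..a} k u x + nderiv {0..a} k v x"
  if "smooth u" "smooth v" "x \<in> {0..a}"
  using that
proof (induction k arbitrary: u v)
  case (Suc k)
  have "nderiv {0..a} (Suc k) (\<lambda>x. u x + v x) x = nderiv {0..a} k (\<lambda>x. D u x + D v x) x"
    unfolding nderiv_Suc' by (intro nderiv_cong D_add) (use Suc.prems in auto)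
  also have "\<dots> = nderiv {0..a} (Suc k) u x + nderiv {0..a} (Suc k) v x"
    unfolding nderiv_Suc' by (rule Suc.IH) (use Suc.prems smooth_D in auto)
  finally show ?case .
qed simp

lemma times_differentiable_mult:
  fixes u v :: "real \<Rightarrow> 'b::real_normed_algebra"
  assumes "times_differentiable k u" "times_differentiable k v"
  shows "times_differentiable k (\<lambda>x. u x * v x)"
  using assms
proof (induction k arbitrary: u v)
  case (Suc k)
  have uv: "times_differentiable k u" "times_differentiable k v"
    by (rule times_differentiable_mono[OF Suc.prems(1)], simp) (rule times_differentiable_mono[OF Suc.prems(2)], simp)
  show ?case
    by (rule times_differentiable_SucI[OF has_vector_derivative_mult times_differentiable_add[OF Suc.IH Suc.IH]])
      (fact uv Suc.prems[THEN times_differentiable_SucD(1)] Suc.prems[THEN times_differentiable_SucD(2)])+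
qed simp

lemma smooth_mult [intro]:
  fixes u v :: "real \<Rightarrow> 'b::real_normed_algebra"
  assumes "smooth u" "smooth v"
  shows "smooth (\<lambda>x. u x * v x)"
  using assms by (auto simp: smooth_iff_times_differentiable intro: times_differentiable_mult)

lemma D_mult:
  fixes u v :: "real \<Rightarrow> 'b::real_normed_algebra"
  assumes "smooth u" "smooth v" "x \<in> {0..a}"
  shows "D (\<lambda>x. u x * v x) x = u x * D v x + D u x * v x"
  by (rule D_unique[OF has_vector_derivative_mult[OF smooth_deriv smooth_deriv]]) (use assms in auto)

lemma smooth_cmult [intro]:
  fixes u :: "real \<Rightarrow> 'b::real_normed_algebra"
  shows "smooth u \<Longrightarrow> smooth (\<lambda>x. c * u x)"
  by (intro smooth_mult smooth_const)

lemma smooth_sum [intro]: "(\<And>i. i \<in> I \<Longrightarrow> smooth (u i)) \<Longrightarrow> smooth (\<lambda>x. \<Sum>i\<in>I. u i x)"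
  by (induction I rule: infinite_finite_induct) auto

lemma nderiv_cmult:
  fixes u :: "real \<Rightarrow> 'b::real_normed_algebra"
  assumes "smooth u" "x \<in> {0..a}"
  shows "nderiv {0..a} k (\<lambda>x. c * u x) x = c * nderiv {0..a} k u x"
  using smooth_bounded_linear(2)[OF bounded_linear_mult_right assms] .

lemma nderiv_zero: "x \<in> {0..a} \<Longrightarrow> nderiv {0..a} k (\<lambda>_. 0) x = 0"
  using smooth_bounded_linear(2)[OF bounded_linear_zero smooth_const] by simp

lemma nderiv_sum:
  assumes "finite I" "\<And>i. i \<in> I \<Longrightarrow> smooth (u i)" "x \<in> {0..a}"
  shows "nderiv {0..a} k (\<lambda>x. \<Sum>i\<in>I. u i x) x = (\<Sum>i\<in>I. nderiv {0..a} k (u i) x)"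
  using assms
  by (induction I rule: finite_induct) (simp_all add: nderiv_zero nderiv_add smooth_sum)

lemma smooth_inverse:
  fixes u :: "real \<Rightarrow> 'b::real_normed_field"
  assumes u: "smooth u" and nz: "\<And>x. x \<in> {0..a} \<Longrightarrow> u x \<noteq> 0"
  shows "smooth (\<lambda>x. inverse (u x))"
proof -
  have "times_differentiable k (\<lambda>x. inverse (u x))" for k
  proof (induction k)
    case (Suc k)
    have d: "((\<lambda>x. inverse (u x)) has_vector_derivative - (inverse (u x) * D u x * inverse (u x)))
        (at x within {0..a})" if x: "x \<in> {0..a}" for x
      using Deriv.has_derivative_inverse[OF nz[OF x] smooth_deriv[OF u x, unfolded has_vector_derivative_def]]
      by (simp add: has_vector_derivative_def algebra_simps)
    have "times_differentiable k (\<lambda>x. - 1 * (inverse (u x) * D u x * inverse (u x)))"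
      using Suc smooth_D[OF u] smooth_const[of "- 1 :: 'b"]
      unfolding smooth_iff_times_differentiable by (intro times_differentiable_mult) auto
    then show ?case by (intro times_differentiable_SucI[OF d]) auto
  qed simp
  then show ?thesis by (simp add: smooth_iff_times_differentiable)
qed

lemma smooth_divide:
  fixes u v :: "real \<Rightarrow> 'b::real_normed_field"
  assumes "smooth u" "smooth v" "\<And>x. x \<in> {0..a} \<Longrightarrow> v x \<noteq> 0"
  shows "smooth (\<lambda>x. u x / v x)"
  using smooth_mult[OF assms(1) smooth_inverse[OF assms(2,3)]] by (simp add: divide_inverse)

lemma smooth_powr:
  fixes u :: "real \<Rightarrow> real"
  assumes u: "smooth u" and pos: "\<And>x. x \<in> {0..a} \<Longrightarrow> u x > 0"
  shows "smooth (\<lambda>x. u x powr p)"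
proof -
  have "times_differentiable k (\<lambda>x. u x powr p)" for k
  proof (induction k)
    case (Suc k)
    have d: "((\<lambda>x. u x powr p) has_vector_derivative p * (D u x * (inverse (u x) * u x powr p)))
        (at x within {0..a})" if x: "x \<in> {0..a}" for x
    proof -
      have "((\<lambda>z. z powr p) has_real_derivative p * u x powr (p - 1)) (at (u x) within u ` {0..a})"
        using has_real_derivative_powr[OF pos[OF x]] by (rule has_field_derivative_at_within)
      from field_vector_diff_chain_within[OF smooth_deriv[OF u x] this]
      show ?thesis
        using pos[OF x] by (simp add: o_def powr_diff divide_inverse mult_ac)
    qed
    have "times_differentiable k (\<lambda>x. p * (D u x * (inverse (u x) * u x powr p)))"
      using Suc smooth_D[OF u] smooth_const[of p] smooth_inverse[OF u] pos
      unfolding smooth_iff_times_differentiable by (intro times_differentiable_mult) fastforce+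
    then show ?case by (intro times_differentiable_SucI[OF d]) auto
  qed simp
  then show ?thesis by (simp add: smooth_iff_times_differentiable)
qed

lemma smooth_of_real:
  fixes u :: "real \<Rightarrow> real"
  assumes "smooth u"
  shows "smooth (\<lambda>x. complex_of_real (u x))"
    and "x \<in> {0..a} \<Longrightarrow> nderiv {0..a} k (\<lambda>x. complex_of_real (u x)) x = of_real (nderiv {0..a} k u x)"
  using smooth_bounded_linear[OF bounded_linear_of_real assms] by auto

text \<open>Differentiation under the integral sign raises the power of t by one and replaces u by u', which
is why the moment j is arbitrary.\<close>

lemma smooth_moment_average:
  fixes u :: "real \<Rightarrow> 'b::banach"
  assumes "smooth u"
  shows "smooth (\<lambda>x. integral {0..1} (\<lambda>t. t ^ j *\<^sub>R u (t * x)))"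
proof -
  have "times_differentiable k (\<lambda>x. integral {0..1} (\<lambda>t. t ^ j *\<^sub>R u (t * x)))" for k
    using assms
  proof (induction k arbitrary: u j)
    case (Suc k)
    have mem: "t * x \<in> {0..a}" if "x \<in> {0..a}" "t \<in> {0..1}" for x t
      using that mult_left_le_one_le[of x t] by auto
    have mem': "t * x \<le> a" if "0 \<le> x" "x \<le> a" "0 \<le> t" "t \<le> 1" for x t
      using mem[of x t] that by simp
    have cont: "continuous_on ({0..a} \<times> cbox 0 1) (\<lambda>(x, t). t ^ j *\<^sub>R v (t * x))"
      if "smooth v" for j and v :: "real \<Rightarrow> 'b"
      unfolding split_beta
      by (intro continuous_intros continuous_on_compose2[OF smooth_continuous[OF that]])
        (auto simp: mem')
    show ?case
    proof (rule times_differentiable_SucI)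
      show "times_differentiable k (\<lambda>x. integral {0..1} (\<lambda>t. t ^ Suc j *\<^sub>R D u (t * x)))"
        using Suc smooth_D by blast
      fix x assume x: "x \<in> {0..a}"
      have "((\<lambda>x. integral (cbox 0 1) (\<lambda>t. t ^ j *\<^sub>R u (t * x))) has_vector_derivative
          integral (cbox 0 1) (\<lambda>t. t ^ Suc j *\<^sub>R D u (t * x))) (at x within {0..a})"
      proof (rule leibniz_rule_vector_derivative[where fx = "\<lambda>x t. t ^ Suc j *\<^sub>R D u (t * x)"])
        fix x t :: real assume xt: "x \<in> {0..a}" "t \<in> cbox 0 1"
        have "((\<lambda>x. t * x) has_vector_derivative t) (at x within {0..a})"
          by (auto intro!: derivative_eq_intros)
        moreover have "(u has_vector_derivative D u (t * x)) (at (t * x) within (\<lambda>x. t * x) ` {0..a})"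
          using smooth_deriv[OF Suc.prems mem[of x t]] xt mem
          by (auto intro: has_vector_derivative_within_subset)
        ultimately have "((\<lambda>x. u (t * x)) has_vector_derivative t *\<^sub>R D u (t * x)) (at x within {0..a})"
          using vector_diff_chain_within by (fastforce simp: o_def)
        then have "((\<lambda>x. t ^ j *\<^sub>R u (t * x)) has_vector_derivative t ^ j *\<^sub>R t *\<^sub>R D u (t * x)) (at x within {0..a})"
          by (rule bounded_linear.has_vector_derivative[OF bounded_linear_scaleR_right])
        then show "((\<lambda>x. t ^ j *\<^sub>R u (t * x)) has_vector_derivative t ^ Suc j *\<^sub>R D u (t * x)) (at x within {0..a})"
          by (simp add: mult.commute)
      next
        fix x assume x: "x \<in> {0..a}"
        have "continuous_on (cbox 0 1) (\<lambda>t. t ^ j *\<^sub>R u (t * x))"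
          by (intro continuous_intros continuous_on_compose2[OF smooth_continuous[OF Suc.prems]])
            (use mem x in auto)
        then show "(\<lambda>t. t ^ j *\<^sub>R u (t * x)) integrable_on cbox 0 1"
          by (rule integrable_continuous)
      qed (use cont[OF smooth_D[OF Suc.prems], of "Suc j"] x in auto)
      then show "((\<lambda>x. integral {0..1} (\<lambda>t. t ^ j *\<^sub>R u (t * x))) has_vector_derivative
          integral {0..1} (\<lambda>t. t ^ Suc j *\<^sub>R D u (t * x))) (at x within {0..a})"
        by simp
    qed
  qed simp
  then show ?thesis by (simp add: smooth_iff_times_differentiable)
qed

text \<open>Hadamard's lemma, with the quotient \<integral>_0^1 u'(tx) dt.\<close>

lemma hadamard_division:
  fixes u :: "real \<Rightarrow> 'b::banach"
  assumes "smooth u"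
  shows "\<exists>r. smooth r \<and> (\<forall>x\<in>{0..a}. u x = u 0 + x *\<^sub>R r x) \<and> r 0 = D u 0"
proof (intro exI conjI ballI)
  let ?r = "\<lambda>x. integral {0..1} (\<lambda>t. t ^ 0 *\<^sub>R D u (t * x))"
  show "smooth ?r"
    by (rule smooth_moment_average[OF smooth_D[OF assms]])
  show "?r 0 = D u 0" by simp
  fix x assume x: "x \<in> {0..a}"
  have mem: "t * x \<in> {0..a}" if "t \<in> {0..1}" for t
    using that x mult_left_le_one_le[of x t] by auto
  have "((\<lambda>t. x *\<^sub>R D u (t * x)) has_integral u (1 * x) - u (0 * x)) {0..1}"
  proof (rule fundamental_theorem_of_calculus)
    fix t :: real assume t: "t \<in> {0..1}"
    have "((\<lambda>t. t * x) has_vector_derivative x) (at t within {0..1})"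
      by (auto intro!: derivative_eq_intros)
    moreover have "(u has_vector_derivative D u (t * x)) (at (t * x) within (\<lambda>t. t * x) ` {0..1})"
      using smooth_deriv[OF assms mem[OF t]] mem
      by (auto intro: has_vector_derivative_within_subset)
    ultimately show "((\<lambda>t. u (t * x)) has_vector_derivative x *\<^sub>R D u (t * x)) (at t within {0..1})"
      using vector_diff_chain_within by (fastforce simp: o_def)
  qed simp
  from integral_unique[OF this] show "u x = u 0 + x *\<^sub>R ?r x"
    by (simp add: algebra_simps)
qed

lemma smooth_exp:
  fixes u :: "real \<Rightarrow> complex"
  assumes u: "smooth u"
  shows "smooth (\<lambda>x. exp (u x))" 
    and "x \<in> {0..a} \<Longrightarrow> ((\<lambda>x. exp (u x)) has_vector_derivative D u x * exp (u x)) (at x within {0..a})"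
proof -
  show d: "((\<lambda>x. exp (u x)) has_vector_derivative D u x * exp (u x)) (at x within {0..a})"
    if "x \<in> {0..a}" for x
    using field_vector_diff_chain_within[OF smooth_deriv[OF u that] has_field_derivative_at_within[OF DERIV_exp]]
    by (simp add: o_def)
  have "times_differentiable k (\<lambda>x. exp (u x))" for k
  proof (induction k)
    case (Suc k)
    then have "times_differentiable k (\<lambda>x. D u x * exp (u x))"
      using smooth_D[OF u] by (intro times_differentiable_mult) (auto simp: smooth_iff_times_differentiable)
    then show ?case by (intro times_differentiable_SucI[OF d])
  qed simp
  then show "smooth (\<lambda>x. exp (u x))" by (simp add: smooth_iff_times_differentiable)
qed

lemma smooth_deriv_at:
  "(u has_vector_derivative D u x) (at x)" if "smooth u" "0 < x" "x < a"
  using smooth_deriv[of u x] that by (simp add: at_within_Icc_at)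

lemma smooth_bounded:
  assumes "smooth u"
  shows "\<exists>C\<ge>0. \<forall>x\<in>{0..a}. norm (u x) \<le> C"
proof -
  have "compact (u ` {0..a})"
    by (intro compact_continuous_image smooth_continuous assms) auto
  then obtain C where C: "\<forall>y\<in>u ` {0..a}. norm y \<le> C"
    using compact_imp_bounded bounded_iff by blast
  show ?thesis
    by (intro exI[of _ "max C 0"]) (use C in \<open>auto simp: le_max_iff_disj\<close>)
qed

section \<open>Zeros with multiplicity\<close>

definition vanishes :: "nat \<Rightarrow> (real \<Rightarrow> 'a::real_normed_vector) \<Rightarrow> real \<Rightarrow> bool" where
  "vanishes k u x \<longleftrightarrow> (\<forall>j<k. nderiv {0..a} j u x = 0)"

lemma vanishes_0 [simp]: "vanishes 0 u x"
  by (simp add: vanishes_def)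

lemma vanishes_Suc: "vanishes (Suc k) u x \<longleftrightarrow> u x = 0 \<and> vanishes k (D u) x"
  by (auto simp: vanishes_def nderiv_Suc' less_Suc_eq_0_disj)

lemma vanishes_mono: "vanishes l u x \<Longrightarrow> k \<le> l \<Longrightarrow> vanishes k u x"
  by (auto simp: vanishes_def)

lemma vanishes_cong:
  assumes "\<And>x. x \<in> {0..a} \<Longrightarrow> u x = v x" "x \<in> {0..a}"
  shows "vanishes k u x \<longleftrightarrow> vanishes k v x"
  using nderiv_cong[OF assms] by (simp add: vanishes_def)

lemma vanishes_add:
  "vanishes k (\<lambda>x. u x + v x) x"
  if "vanishes k u x" "vanishes k v x" "smooth u" "smooth v" "x \<in> {0..a}"
  using that by (simp add: vanishes_def nderiv_add)

lemma vanishes_cmult: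
  fixes u :: "real \<Rightarrow> 'b::real_normed_algebra"
  assumes "vanishes k u x" "smooth u" "x \<in> {0..a}"
  shows "vanishes k (\<lambda>x. c * u x) x"
  using assms by (simp add: vanishes_def nderiv_cmult)

lemma vanishes_mult:
  fixes u v :: "real \<Rightarrow> 'b::{real_normed_algebra,comm_ring}"
  assumes "vanishes k u x" "smooth u" "smooth v" "x \<in> {0..a}"
  shows "vanishes k (\<lambda>x. u x * v x) x"
  using assms
proof (induction k arbitrary: u v)
  case (Suc k)
  have u: "vanishes k u x" "vanishes k (D u) x" "u x = 0"
    using Suc.prems(1) vanishes_mono[OF Suc.prems(1), of k] by (auto simp: vanishes_Suc)
  have "vanishes k (\<lambda>x. u x * D v x + D u x * v x) x"
    using Suc.prems u by (intro vanishes_add Suc.IH smooth_mult smooth_D) auto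
  then have "vanishes k (D (\<lambda>x. u x * v x)) x"
    by (subst vanishes_cong[OF D_mult]) (use Suc.prems in auto)
  then show ?case using u by (simp add: vanishes_Suc)
qed simp

text \<open>By the product rule v u' = (v u)' - v' u. So if u vanishes to order k, then so does v u', and by
induction u'; this gives order k + 1 for u.\<close>

lemma vanishes_cancel_nonzero_factor:
  fixes u v :: "real \<Rightarrow> 'b::real_normed_field"
  assumes "vanishes k (\<lambda>x. v x * u x) x" "v x \<noteq> 0" "smooth u" "smooth v" "x \<in> {0..a}"
  shows "vanishes k u x"
  using assms
proof (induction k arbitrary: u)
  case (Suc k)
  have 1: "vanishes k (\<lambda>x. v x * u x) x" "vanishes k (D (\<lambda>x. v x * u x)) x" "u x = 0"
    using Suc.prems vanishes_mono[OF Suc.prems(1), of k] by (auto simp: vanishes_Suc)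
  have u: "vanishes k u x" using 1 Suc by blast
  have "vanishes k (\<lambda>x. v x * D u x + D v x * u x) x"
    using 1(2) by (subst (asm) vanishes_cong[OF D_mult]) (use Suc.prems in auto)
  moreover have "vanishes k (\<lambda>x. - 1 * (u x * D v x)) x"
    using Suc.prems u by (intro vanishes_cmult vanishes_mult smooth_mult smooth_D) auto
  ultimately have "vanishes k (\<lambda>x. (v x * D u x + D v x * u x) + - 1 * (u x * D v x)) x"
    by (rule vanishes_add)
      (use Suc.prems in \<open>intro smooth_add smooth_mult smooth_const smooth_D | simp\<close>)+
  then have "vanishes k (\<lambda>x. v x * D u x) x" by (simp add: mult.commute)
  then have "vanishes k (D u) x" using Suc smooth_D by blast
  then show ?case using 1 by (simp add: vanishes_Suc)
qed simp

text \<open>The derivative of order j+1 of x u is x times that of u, plus j+1 times the derivative of order j of u;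
at 0 only the latter is left.\<close>

lemma vanishes_cancel_ident:
  fixes u :: "real \<Rightarrow> complex"
  assumes "vanishes (Suc k) (\<lambda>x. of_real x * u x) 0" "smooth u"
  shows "vanishes k u 0"
proof -
  have X: "smooth (\<lambda>x. complex_of_real x)" "\<And>x. x \<in> {0..a} \<Longrightarrow> D (\<lambda>x. complex_of_real x) x = 1"
    using smooth_of_real(1)[OF smooth_ident] D_unique[OF has_vector_derivative_of_real[OF DERIV_ident]]
    by simp_all
  have key: "nderiv {0..a} (Suc j) (\<lambda>x. of_real x * u x) x =
      of_real x * nderiv {0..a} (Suc j) u x + of_nat (Suc j) * nderiv {0..a} j u x"
    if "x \<in> {0..a}" "smooth u" for j x and u :: "real \<Rightarrow> complex"
    using that
  proof (induction j arbitrary: u x)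
      case 0
      then show ?case using D_mult[OF X(1), of u x] X(2)[of x] by simp
    next
      case (Suc j)
      have "nderiv {0..a} (Suc (Suc j)) (\<lambda>x. of_real x * u x) x
          = nderiv {0..a} (Suc j) (\<lambda>x. of_real x * D u x + u x) x"
        unfolding nderiv_Suc'[of "Suc j"]
        by (rule nderiv_cong) (use Suc.prems X D_mult[OF X(1), of u] in auto)
      also have "\<dots> = nderiv {0..a} (Suc j) (\<lambda>x. of_real x * D u x) x + nderiv {0..a} (Suc j) u x"
        using Suc.prems X by (intro nderiv_add smooth_mult smooth_D) auto
      finally show ?case
        using Suc.IH[OF Suc.prems(1) smooth_D[OF Suc.prems(2)]]
        by (simp add: nderiv_Suc'[symmetric] algebra_simps)
  qed
  show ?thesis
    unfolding vanishes_def
  proof (intro allI impI)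
    fix j assume "j < k"
    then have "nderiv {0..a} (Suc j) (\<lambda>x. of_real x * u x) 0 = 0"
      using assms(1) by (auto simp: vanishes_def)
    then have "of_nat (Suc j) * nderiv {0..a} j u 0 = 0"
      using key[of 0 u j] assms(2) a_pos by simp
    then show "nderiv {0..a} j u 0 = 0"
      by (metis mult_eq_0_iff of_nat_neq_0)
  qed
qed

end

section \<open>Weighted oscillatory integrals\<close>

text \<open>Here g is the phase of the oscillator e^(iwg) and g^\<alpha> carries the endpoint singularity.\<close>

locale phase = initial_interval +
  fixes g :: "real \<Rightarrow> real" and \<alpha> :: real
  assumes g_smooth: "smooth g" and g_0: "g 0 = 0"
    and Dg_pos: "x \<in> {0..a} \<Longrightarrow> D g x > 0"
    and \<alpha>_gt: "\<alpha> > - 1" and \<alpha>_nz: "\<alpha> \<noteq> 0"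
begin

lemma g_strict_mono: "g x < g y" if "0 \<le> x" "x < y" "y \<le> a"
proof (rule DERIV_pos_imp_increasing_open[OF that(2)])
  fix t assume t: "x < t" "t < y"
  then have "(g has_vector_derivative D g t) (at t)"
    using that by (intro smooth_deriv_at g_smooth) auto
  then show "\<exists>d. (g has_real_derivative d) (at t) \<and> 0 < d"
    using Dg_pos[of t] t that by (auto simp: has_real_derivative_iff_has_vector_derivative)
next
  show "continuous_on {x..y} g"
    by (rule continuous_on_subset[OF smooth_continuous[OF g_smooth]]) (use that in auto)
qed

lemma g_pos: "g x > 0" if "0 < x" "x \<le> a"
  using g_strict_mono[of 0 x] that g_0 by simp

lemma g_nonneg: "g x \<ge> 0" if "x \<in> {0..a}"
  using g_pos[of x] g_0 that by (cases "x = 0") auto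

lemma g_eq_0_iff: "g x = 0 \<longleftrightarrow> x = 0" if "x \<in> {0..a}"
  using g_pos[of x] g_0 that by (cases "x = 0") auto

abbreviation gc :: "real \<Rightarrow> complex" where "gc x \<equiv> of_real (g x)"
abbreviation g'c :: "real \<Rightarrow> complex" where "g'c x \<equiv> of_real (D g x)"

lemma smooth_gc: "smooth gc" and D_gc: "x \<in> {0..a} \<Longrightarrow> D gc x = g'c x"
  and smooth_g'c: "smooth g'c"
  using smooth_of_real(1)[OF g_smooth] smooth_of_real(2)[OF g_smooth, of x 1]
    smooth_of_real(1)[OF smooth_D[OF g_smooth]] by simp_all

lemma g'c_nz: "x \<in> {0..a} \<Longrightarrow> g'c x \<noteq> 0"
  using Dg_pos[of x] by simp

text \<open>The function \<gamma> = g(x)/x, extended by g'(0), has no zeros. Dividing by g is therefore dividing by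
x and then by a smooth function without zeros.\<close>

lemma slope:
  "\<exists>\<gamma>. smooth \<gamma> \<and> (\<forall>x\<in>{0..a}. g x = x * \<gamma> x \<and> \<gamma> x > 0) \<and> \<gamma> 0 = D g 0"
proof -
  obtain \<gamma> where \<gamma>: "smooth \<gamma>" "\<forall>x\<in>{0..a}. g x = g 0 + x *\<^sub>R \<gamma> x" "\<gamma> 0 = D g 0"
    using hadamard_division[OF g_smooth] by blast
  have "\<gamma> x > 0" if "x \<in> {0..a}" for x
    using bspec[OF \<gamma>(2) that] \<gamma>(3) g_pos[of x] Dg_pos[OF that] that g_0
    by (cases "x = 0") (auto simp: zero_less_mult_iff)
  with \<gamma> show ?thesis by (intro exI[of _ \<gamma>]) (auto simp: g_0)
qed

text \<open>The value at 0 is the limit from the right, so that the quotient of smooth functions is smooth.\<close>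

definition quot :: "(real \<Rightarrow> complex) \<Rightarrow> real \<Rightarrow> complex" where
  "quot u x = (if x = 0 then D u 0 / g'c 0 else (u x - u 0) / gc x)"

lemma quot_eq: "u x = u 0 + gc x * quot u x" if "x \<in> {0..a}"
  using g_eq_0_iff[OF that] g_0 by (auto simp: quot_def)

lemma quot_factor:
  assumes "smooth u"
  shows "\<exists>r \<gamma>. smooth r \<and> smooth \<gamma> \<and> (\<forall>x\<in>{0..a}. \<gamma> x > 0 \<and>
    u x = u 0 + of_real x * r x \<and> quot u x = r x * inverse (complex_of_real (\<gamma> x)))"
proof -
  obtain \<gamma> where \<gamma>: "smooth \<gamma>" "\<forall>x\<in>{0..a}. g x = x * \<gamma> x \<and> \<gamma> x > 0" "\<gamma> 0 = D g 0"
    using slope by blast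
  obtain r where r: "smooth r" "\<forall>x\<in>{0..a}. u x = u 0 + x *\<^sub>R r x" "r 0 = D u 0"
    using hadamard_division[OF assms] by blast
  have "quot u x = r x * inverse (complex_of_real (\<gamma> x))" if "x \<in> {0..a}" for x
    using bspec[OF r(2) that] r(3) bspec[OF \<gamma>(2) that] \<gamma>(3)
    by (auto simp: quot_def divide_simps scaleR_conv_of_real)
  moreover have "\<gamma> x > 0" "u x = u 0 + of_real x * r x" if "x \<in> {0..a}" for x
    using bspec[OF r(2) that] bspec[OF \<gamma>(2) that] by (simp_all only: scaleR_conv_of_real)
  ultimately show ?thesis
    using \<gamma>(1) r(1) by (intro exI[of _ r] exI[of _ \<gamma>] conjI ballI) assumption+
qed

lemma smooth_quot:
  assumes u: "smooth u"
  shows "smooth (quot u)"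
proof -
  obtain r \<gamma> where *: "smooth r" "smooth \<gamma>" "\<forall>x\<in>{0..a}. \<gamma> x > 0 \<and>
    u x = u 0 + of_real x * r x \<and> quot u x = r x * inverse (complex_of_real (\<gamma> x))"
    using quot_factor[OF u] by blast
  have "smooth (\<lambda>x. r x * inverse (complex_of_real (\<gamma> x)))"
    using *(3) by (intro smooth_mult smooth_inverse smooth_of_real(1) *(1,2)) force
  then show ?thesis
    using smooth_cong[of "quot u" "\<lambda>x. r x * inverse (complex_of_real (\<gamma> x))"] *(3) by simp
qed

text \<open>The effect of one integration by parts on the amplitude, see \<open>osc_integral_integration_by_parts\<close>.
Subtracting u(0) inside \<open>quot\<close> makes it linear on all smooth functions, not only on those
that vanish at 0; this is what allows it to be applied term by term.\<close>

definition ibp :: "(real \<Rightarrow> complex) \<Rightarrow> real \<Rightarrow> complex" where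
  "ibp u x = of_real \<alpha> * quot u x + D u x / g'c x"

lemma smooth_ibp: "smooth (ibp u)" if "smooth u"
  unfolding ibp_def[abs_def]
  by (intro smooth_add smooth_cmult smooth_divide smooth_quot smooth_D smooth_g'c that g'c_nz)

text \<open>With u = x r and g = x \<gamma> the quotient u/g = r/\<gamma> loses exactly the factor x.\<close>

lemma vanishes_ibp_0: 
  assumes u: "smooth u" and van: "vanishes (Suc k) u 0"
  shows "vanishes k (ibp u) 0"
proof -
  have 0: "0 \<in> {0..a}" using a_pos by simp
  have u0: "u 0 = 0" using van by (simp add: vanishes_Suc)
  obtain r \<gamma> where *: "smooth r" "smooth \<gamma>" "\<forall>x\<in>{0..a}. \<gamma> x > 0 \<and>
    u x = u 0 + of_real x * r x \<and> quot u x = r x * inverse (complex_of_real (\<gamma> x))"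
    using quot_factor[OF u] by blast
  have inv: "smooth (\<lambda>x. inverse (complex_of_real (\<gamma> x)))"
    using *(3) by (intro smooth_inverse smooth_of_real(1) *(1,2)) force
  have "vanishes (Suc k) (\<lambda>x. of_real x * r x) 0"
    using van vanishes_cong[of u "\<lambda>x. of_real x * r x" 0] *(3) u0 0 by simp
  then have "vanishes k r 0" using *(1) by (rule vanishes_cancel_ident)
  then have "vanishes k (\<lambda>x. r x * inverse (complex_of_real (\<gamma> x))) 0"
    using * inv 0 by (intro vanishes_mult)
  then have "vanishes k (quot u) 0"
    using vanishes_cong[of "quot u" "\<lambda>x. r x * inverse (complex_of_real (\<gamma> x))" 0] *(3) 0 by simp
  moreover have "vanishes k (\<lambda>x. D u x * inverse (g'c x)) 0"
    using van by (intro vanishes_mult smooth_D u smooth_inverse smooth_g'c g'c_nz 0) (auto simp: vanishes_Suc)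
  ultimately show ?thesis
    unfolding ibp_def[abs_def] divide_inverse
    by (intro vanishes_add vanishes_cmult smooth_cmult smooth_quot u 0 smooth_mult smooth_D
        smooth_inverse smooth_g'c g'c_nz)
qed

lemma vanishes_ibp_a: 
  assumes u: "smooth u" and van: "vanishes (Suc k) u a" and u0: "u 0 = 0"
  shows "vanishes k (ibp u) a"
proof -
  have a: "a \<in> {0..a}" using a_pos by simp
  have "vanishes (Suc k) (\<lambda>x. gc x * quot u x) a"
    using van vanishes_cong[of u "\<lambda>x. gc x * quot u x" a] quot_eq[of _ u] u0 a by simp
  then have "vanishes (Suc k) (quot u) a"
    by (rule vanishes_cancel_nonzero_factor) (use g_pos[of a] a_pos in \<open>simp_all add: smooth_quot u smooth_gc\<close>)
  then have "vanishes k (quot u) a" by (rule vanishes_mono) simp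
  moreover have "vanishes k (\<lambda>x. D u x * inverse (g'c x)) a"
    using van by (intro vanishes_mult smooth_D u smooth_inverse smooth_g'c g'c_nz a) (auto simp: vanishes_Suc)
  ultimately show ?thesis
    unfolding ibp_def[abs_def] divide_inverse
    by (intro vanishes_add vanishes_cmult smooth_cmult smooth_quot u a smooth_mult smooth_D
        smooth_inverse smooth_g'c g'c_nz)
qed

lemma ibp_cong:
  assumes "\<And>x. x \<in> {0..a} \<Longrightarrow> u x = v x" "x \<in> {0..a}"
  shows "ibp u x = ibp v x"
  using assms D_cong[OF assms(1)] a_pos by (auto simp: ibp_def quot_def)

lemma ibp_lincomb:
  assumes I: "finite I" and u: "\<And>i. i \<in> I \<Longrightarrow> smooth (u i)" and x: "x \<in> {0..a}"
  shows "ibp (\<lambda>x. \<Sum>i\<in>I. c i * u i x) x = (\<Sum>i\<in>I. c i * ibp (u i) x)"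
proof -
  have D: "D (\<lambda>x. \<Sum>i\<in>I. c i * u i x) y = (\<Sum>i\<in>I. c i * D (u i) y)" if "y \<in> {0..a}" for y
  proof -
    have "D (\<lambda>x. \<Sum>i\<in>I. c i * u i x) y = (\<Sum>i\<in>I. D (\<lambda>x. c i * u i x) y)"
      using nderiv_sum[OF I, of "\<lambda>i x. c i * u i x" y 1] u that by (simp add: smooth_cmult)
    also have "\<dots> = (\<Sum>i\<in>I. c i * D (u i) y)"
      using nderiv_cmult[OF u that, of _ 1] by (intro sum.cong) auto
    finally show ?thesis .
  qed
  have "quot (\<lambda>x. \<Sum>i\<in>I. c i * u i x) x = (\<Sum>i\<in>I. c i * quot (u i) x)"
    using D[of 0] a_pos
    by (auto simp: quot_def sum_divide_distrib sum_subtractf diff_divide_distrib right_diff_distrib)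
  then show ?thesis
    using D[OF x] by (simp add: ibp_def sum.distrib sum_distrib_left sum_divide_distrib algebra_simps)
qed

lemma smooth_ibp_pow: "smooth ((ibp ^^ k) u)" if "smooth u"
  using that by (induction k) (auto intro: smooth_ibp)

lemma ibp_pow_lincomb:
  assumes I: "finite I" and u: "\<And>i. i \<in> I \<Longrightarrow> smooth (u i)" and x: "x \<in> {0..a}"
  shows "(ibp ^^ k) (\<lambda>x. \<Sum>i\<in>I. c i * u i x) x = (\<Sum>i\<in>I. c i * (ibp ^^ k) (u i) x)"
  using x
proof (induction k arbitrary: x)
  case (Suc k)
  have "(ibp ^^ Suc k) (\<lambda>x. \<Sum>i\<in>I. c i * u i x) x = ibp (\<lambda>x. \<Sum>i\<in>I. c i * (ibp ^^ k) (u i) x) x"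
    unfolding funpow.simps o_def by (rule ibp_cong[OF Suc.IH Suc.prems])
  also have "\<dots> = (\<Sum>i\<in>I. c i * ibp ((ibp ^^ k) (u i)) x)"
    by (rule ibp_lincomb[OF I smooth_ibp_pow[OF u] Suc.prems])
  finally show ?case by simp
qed simp

abbreviation osc :: "real \<Rightarrow> real \<Rightarrow> complex" where
  "osc w x \<equiv> exp (\<i> * of_real w * gc x)"

lemma smooth_osc: "smooth (osc w)"
  by (intro smooth_exp(1) smooth_cmult smooth_gc)

lemma osc_deriv:
  assumes "x \<in> {0..a}"
  shows "(osc w has_vector_derivative \<i> * of_real w * g'c x * osc w x) (at x within {0..a})"
proof -
  have "D (\<lambda>x. \<i> * of_real w * gc x) x = \<i> * of_real w * g'c x"
    using nderiv_cmult[OF smooth_gc assms, of 1 "\<i> * of_real w"] D_gc[OF assms] by simp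
  then show ?thesis
    using smooth_exp(2)[OF smooth_cmult[OF smooth_gc] assms, of "\<i> * of_real w"] by simp
qed

lemma osc_deriv_at:
  "(osc w has_vector_derivative \<i> * of_real w * g'c x * osc w x) (at x)" if "0 < x" "x < a"
  using osc_deriv[of x w] that by (simp add: at_within_Icc_at)

lemma norm_osc [simp]: "norm (osc w x) = 1"
proof -
  have "osc w x = exp (\<i> * of_real (w * g x))" by (simp add: mult.assoc)
  then show ?thesis by (simp only: norm_exp_i_times)
qed

lemma g_powr_deriv:
  assumes "0 < x" "x < a"
  shows "((\<lambda>x. g x powr p) has_real_derivative p * g x powr (p - 1) * D g x) (at x)"
proof -
  have "(g has_real_derivative D g x) (at x)"
    using smooth_deriv_at[OF g_smooth assms] by (simp add: has_real_derivative_iff_has_vector_derivative)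
  from DERIV_chain2[OF has_real_derivative_powr[OF g_pos] this, of p] assms
  show ?thesis by simp
qed

lemma continuous_g_powr: "continuous_on {c..d} (\<lambda>x. g x powr p)"
  if "0 \<le> c" "d \<le> a" "p > 0 \<or> c > 0"
proof -
  have "continuous_on {c..d} g"
    by (rule continuous_on_subset[OF smooth_continuous[OF g_smooth]]) (use that in auto)
  moreover have "0 \<le> g x \<and> (g x = 0 \<longrightarrow> 0 < p)" if "x \<in> {c..d}" for x
    using g_nonneg[of x] g_eq_0_iff[of x] that \<open>0 \<le> c\<close> \<open>d \<le> a\<close> \<open>p > 0 \<or> c > 0\<close> by auto
  ultimately show ?thesis
    by (intro continuous_on_powr' continuous_on_const) auto
qed

lemma g_powr_integral:
  assumes "0 \<le> c" "c \<le> d" "d \<le> a" "p > 0 \<or> c > 0"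
  shows "((\<lambda>x. p * g x powr (p - 1) * D g x) has_integral g d powr p - g c powr p) {c..d}"
proof (rule fundamental_theorem_of_calculus_interior)
  fix x assume "x \<in> {c<..<d}"
  then show "((\<lambda>x. g x powr p) has_vector_derivative p * g x powr (p - 1) * D g x) (at x)"
    using g_powr_deriv[of x p] assms by (simp add: has_real_derivative_iff_has_vector_derivative)
qed (use assms continuous_g_powr in auto)

text \<open>For p = \<alpha> the last term is iw times the integrand of the oscillatory integral, so that solving for it
gains the factor 1/w.\<close>

lemma boundary_deriv:
  assumes u: "smooth u" and x: "0 < x" "x < a"
  shows "((\<lambda>x. of_real (g x powr p) * (u x * osc w x)) has_vector_derivative
     (of_real (p * g x powr (p - 1) * D g x) * u x + of_real (g x powr p) * D u x) * osc w x
      + \<i> * of_real w * (of_real (g x powr p * D g x) * (u x * osc w x))) (at x)"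
proof -
  have "((\<lambda>x. complex_of_real (g x powr p)) has_vector_derivative
      of_real (p * g x powr (p - 1) * D g x)) (at x)"
    by (rule has_vector_derivative_of_real[OF g_powr_deriv[OF x]])
  from has_vector_derivative_mult[OF this
      has_vector_derivative_mult[OF smooth_deriv_at[OF u x] osc_deriv_at[OF x, of w]]]
  show ?thesis by (rule has_vector_derivative_eq_rhs) (simp add: algebra_simps)
qed

text \<open>An integration by parts of \<integral>_0^x g^\<alpha> g' v, which leaves only the continuous integrand g^(\<alpha>+1) v'.
In this form the primitive is visibly continuous up to 0, even where g^\<alpha> is unbounded, so that the
fundamental theorem of calculus yields existence of all singular integrals.\<close>

definition weighted_antideriv :: "(real \<Rightarrow> complex) \<Rightarrow> real \<Rightarrow> complex" where
  "weighted_antideriv v x = (of_real (g x powr (\<alpha> + 1)) * v x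
      - integral {0..x} (\<lambda>t. of_real (g t powr (\<alpha> + 1)) * D v t)) / of_real (\<alpha> + 1)"

lemma continuous_g_powr_times:
  "continuous_on {0..a} (\<lambda>x. complex_of_real (g x powr (\<alpha> + 1)) * v x)" if "smooth v"
  using \<alpha>_gt by (intro continuous_intros continuous_g_powr smooth_continuous that) auto

lemma weighted_antideriv:
  assumes v: "smooth v"
  shows "continuous_on {0..a} (weighted_antideriv v)" "weighted_antideriv v 0 = 0"
    and "0 < x \<Longrightarrow> x < a \<Longrightarrow>
      (weighted_antideriv v has_vector_derivative of_real (g x powr \<alpha> * D g x) * v x) (at x)"
proof -
  have \<alpha>1: "complex_of_real (\<alpha> + 1) \<noteq> 0" using \<alpha>_gt by (simp only: of_real_eq_0_iff)
  have cont: "continuous_on {0..a} (\<lambda>t. complex_of_real (g t powr (\<alpha> + 1)) * D v t)"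
    by (rule continuous_g_powr_times[OF smooth_D[OF v]])
  show "continuous_on {0..a} (weighted_antideriv v)"
    unfolding weighted_antideriv_def[abs_def]
    by (intro continuous_intros continuous_g_powr_times[OF v] \<alpha>1
        indefinite_integral_continuous_1 integrable_continuous_real cont)
      (use \<alpha>1 in auto)
  show "weighted_antideriv v 0 = 0"
    using g_0 by (simp add: weighted_antideriv_def)
  assume x: "0 < x" "x < a"
  have "((\<lambda>y. integral {0..y} (\<lambda>t. complex_of_real (g t powr (\<alpha> + 1)) * D v t)) has_vector_derivative
       of_real (g x powr (\<alpha> + 1)) * D v x) (at x)"
    using integral_has_vector_derivative[OF cont, of x] x by (simp add: at_within_Icc_at)
  moreover have "((\<lambda>x. of_real (g x powr (\<alpha> + 1)) * v x) has_vector_derivative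
      of_real (g x powr (\<alpha> + 1)) * D v x + of_real ((\<alpha> + 1) * g x powr (\<alpha> + 1 - 1) * D g x) * v x) (at x)"
    by (rule has_vector_derivative_mult[OF has_vector_derivative_of_real[OF g_powr_deriv[OF x]] smooth_deriv_at[OF v x]])
  ultimately have "(weighted_antideriv v has_vector_derivative
     (of_real (g x powr (\<alpha> + 1)) * D v x + of_real ((\<alpha> + 1) * g x powr (\<alpha> + 1 - 1) * D g x) * v x
      - of_real (g x powr (\<alpha> + 1)) * D v x) / of_real (\<alpha> + 1)) (at x)"
    unfolding weighted_antideriv_def[abs_def]
    by (intro has_vector_derivative_divide has_vector_derivative_diff)
  then show "(weighted_antideriv v has_vector_derivative of_real (g x powr \<alpha> * D g x) * v x) (at x)"
    by (rule has_vector_derivative_eq_rhs) (use \<alpha>1 in simp)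
qed

lemma weighted_has_integral:
  assumes v: "smooth v" and "0 \<le> c" "c \<le> d" "d \<le> a"
  shows "((\<lambda>x. of_real (g x powr \<alpha> * D g x) * v x) has_integral
    weighted_antideriv v d - weighted_antideriv v c) {c..d}"
proof (rule fundamental_theorem_of_calculus_interior)
  show "continuous_on {c..d} (weighted_antideriv v)"
    by (rule continuous_on_subset[OF weighted_antideriv(1)[OF v]]) (use assms in auto)
qed (use assms weighted_antideriv(3)[OF v] in auto)

text \<open>The factor g' is split off from the amplitude because g' e^(iwg) has the primitive e^(iwg)/(iw).\<close>

definition osc_integral :: "real \<Rightarrow> (real \<Rightarrow> complex) \<Rightarrow> complex" where
  "osc_integral w u = integral {0..a} (\<lambda>x. of_real (g x powr \<alpha> * D g x) * (u x * osc w x))"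

lemma osc_integral_integrable:
  "(\<lambda>x. of_real (g x powr \<alpha> * D g x) * (u x * osc w x)) integrable_on {c..d}"
  if "smooth u" "0 \<le> c" "c \<le> d" "d \<le> a"
  using weighted_has_integral[OF smooth_mult[OF that(1) smooth_osc] that(2-4)]
  by (rule has_integral_integrable)

lemma osc_integral_cong: "osc_integral w u = osc_integral w v" if "\<And>x. x \<in> {0..a} \<Longrightarrow> u x = v x"
  unfolding osc_integral_def using that by (intro integral_cong) auto

lemma osc_integral_lincomb:
  assumes I: "finite I" and u: "\<And>i. i \<in> I \<Longrightarrow> smooth (u i)"
  shows "osc_integral w (\<lambda>x. \<Sum>i\<in>I. c i * u i x) = (\<Sum>i\<in>I. c i * osc_integral w (u i))"
proof -
  have int: "(\<lambda>x. of_real (g x powr \<alpha> * D g x) * (u i x * osc w x)) integrable_on {0..a}" if "i \<in> I" for i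
    using osc_integral_integrable[OF u[OF that], of 0 a] a_pos by simp
  have "((\<lambda>x. \<Sum>i\<in>I. c i * (of_real (g x powr \<alpha> * D g x) * (u i x * osc w x))) has_integral
     (\<Sum>i\<in>I. c i * osc_integral w (u i))) {0..a}"
    unfolding osc_integral_def
    by (intro has_integral_sum I has_integral_mult_right integrable_integral int)
  moreover have "(\<Sum>i\<in>I. c i * (of_real (g x powr \<alpha> * D g x) * (u i x * osc w x)))
     = of_real (g x powr \<alpha> * D g x) * ((\<Sum>i\<in>I. c i * u i x) * osc w x)" for x
    unfolding sum_distrib_left sum_distrib_right by (intro sum.cong) (simp_all add: mult_ac)
  ultimately show ?thesis
    unfolding osc_integral_def by (simp add: integral_unique)
qed

text \<open>The boundary function g^\<alpha> u e^(iwg) equals g^(\<alpha>+1) times a smooth function, because u(0) = 0;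
hence it is continuous at 0 and vanishes there although g^\<alpha> may be unbounded.\<close>

lemma osc_integral_integration_by_parts:
  assumes u: "smooth u" and u0: "u 0 = 0" and ua: "u a = 0"
  shows "\<i> * of_real w * osc_integral w u = - osc_integral w (ibp u)"
proof -
  let ?H = "\<lambda>x. complex_of_real (g x powr \<alpha>) * (u x * osc w x)"
  let ?h = "\<lambda>x. of_real (g x powr \<alpha> * D g x) * (ibp u x * osc w x) +
      \<i> * of_real w * (of_real (g x powr \<alpha> * D g x) * (u x * osc w x))"
  have H_eq: "?H x = of_real (g x powr (\<alpha> + 1)) * (quot u x * osc w x)" if "x \<in> {0..a}" for x
    using quot_eq[OF that, of u] u0 g_nonneg[OF that] g_eq_0_iff[OF that]
    by (cases "x = 0") (auto simp: powr_add)
  have "(?h has_integral ?H a - ?H 0) {0..a}"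
  proof (rule fundamental_theorem_of_calculus_interior)
    show "continuous_on {0..a} ?H"
      using continuous_g_powr_times[OF smooth_mult[OF smooth_quot[OF u] smooth_osc]]
      by (rule iffD2[OF continuous_on_cong[OF refl H_eq], rotated])
    fix x assume x: "x \<in> {0<..<a}"
    have eq: "(of_real (\<alpha> * g x powr (\<alpha> - 1) * D g x) * u x + of_real (g x powr \<alpha>) * D u x) * osc w x
      = of_real (g x powr \<alpha> * D g x) * (ibp u x * osc w x)"
      using quot_eq[of x u] x u0 g_pos[of x] Dg_pos[of x]
      by (simp add: ibp_def powr_diff field_simps)
    show "(?H has_vector_derivative ?h x) (at x)"
      using boundary_deriv[OF u, of x \<alpha> w] x unfolding eq by simp
  qed (use a_pos in auto)
  moreover have "(?h has_integral osc_integral w (ibp u) + \<i> * of_real w * osc_integral w u) {0..a}"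
    unfolding osc_integral_def using a_pos
    by (intro has_integral_add has_integral_mult_right integrable_integral osc_integral_integrable u smooth_ibp) auto
  ultimately have "osc_integral w (ibp u) + \<i> * of_real w * osc_integral w u = ?H a - ?H 0"
    by (rule has_integral_unique[rotated])
  then show ?thesis using u0 ua by (simp add: add_eq_0_iff2)
qed

lemma osc_integral_integration_by_parts_pow:
  assumes "smooth u" "vanishes k u 0" "vanishes k u a"
  shows "(\<i> * of_real w) ^ k * osc_integral w u = (- 1) ^ k * osc_integral w ((ibp ^^ k) u)"
  using assms
proof (induction k arbitrary: u)
  case (Suc k)
  have u0: "u 0 = 0" "u a = 0" using Suc.prems by (auto simp: vanishes_Suc)
  have "(\<i> * of_real w) ^ Suc k * osc_integral w u = (\<i> * of_real w) ^ k * (\<i> * of_real w * osc_integral w u)" by simp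
  also have "\<dots> = - ((\<i> * of_real w) ^ k * osc_integral w (ibp u))"
    unfolding osc_integral_integration_by_parts[OF Suc.prems(1) u0] by simp
  also have "\<dots> = (- 1) ^ Suc k * osc_integral w ((ibp ^^ k) (ibp u))"
    using Suc.IH[OF smooth_ibp vanishes_ibp_0 vanishes_ibp_a] Suc.prems u0 by simp
  finally show ?case by (simp add: funpow_swap1)
qed simp

text \<open>Split at the point \<delta> with g(\<delta>) = 1/w. On [0,\<delta>] the integral is at most a constant times
\<integral>_0^\<delta> g^\<alpha> g' = w^(-1-\<alpha>)/(1+\<alpha>). On [\<delta>,a] integrate by parts once: the boundary terms and the
integral of |\<alpha>| g^(\<alpha>-1) g' are O(1 + w^(-\<alpha>)), to be divided by w. Both signs of \<alpha>
are covered, as w^(-1) and w^(-1-\<alpha>) are both at most w^(-min(1+\<alpha>,1)).\<close>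

lemma osc_integral_decay:
  assumes u: "smooth u"
  shows "\<exists>C\<ge>0. \<forall>\<^sub>F w in at_top. cmod (osc_integral w u) \<le> C * w powr (- min (1 + \<alpha>) 1)"
proof -
  obtain C0 where "C0 \<ge> 0" "\<forall>x\<in>{0..a}. cmod (u x) \<le> C0"
    using smooth_bounded[OF u] by blast
  then have C0: "C0 \<ge> 0" "\<And>x. x \<in> {0..a} \<Longrightarrow> cmod (u x) \<le> C0" by auto
  obtain C1 where "C1 \<ge> 0" "\<forall>x\<in>{0..a}. cmod (D u x / g'c x) \<le> C1"
    using smooth_bounded[OF smooth_divide[OF smooth_D[OF u] smooth_g'c g'c_nz]] by blast
  then have C1: "C1 \<ge> 0" "\<And>x. x \<in> {0..a} \<Longrightarrow> cmod (D u x / g'c x) \<le> C1" by auto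
  have Du: "cmod (D u x) \<le> C1 * D g x" if "x \<in> {0..a}" for x
    using C1(2)[OF that] Dg_pos[OF that] by (simp add: norm_divide divide_simps)
  define b where "b = g a"
  have b: "b > 0" using g_pos a_pos by (simp add: b_def)
  define K where "K = C1 * b powr (\<alpha> + 1) / (\<alpha> + 1)"
  have K: "K \<ge> 0" using C1 \<alpha>_gt by (simp add: K_def)
  \<comment> \<open>the constants of the four terms that the splitting produces below\<close>
  define C where "C = C0 / (\<alpha> + 1) + 2 * C0 * b powr \<alpha> + 2 * C0 + K"
  have "cmod (osc_integral w u) \<le> C * w powr (- min (1 + \<alpha>) 1)" if w: "w \<ge> 1" "w \<ge> 1 / b" for w
  proof -
    have "1 / w \<le> g a" using w b by (simp add: b_def field_simps)
    then obtain \<delta> where \<delta>: "0 \<le> \<delta>" "\<delta> \<le> a" "g \<delta> = 1 / w"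
      using IVT'[of g 0 "1 / w" a] smooth_continuous[OF g_smooth] g_0 a_pos w by auto
    then have \<delta>0: "\<delta> > 0" using g_0 w by (cases "\<delta> = 0") auto
    have g\<delta>: "g \<delta> powr p = w powr (- p)" for p
      using w by (simp add: \<delta>(3) powr_divide powr_minus_divide)
    let ?F = "\<lambda>x. of_real (g x powr \<alpha> * D g x) * (u x * osc w x)"
    let ?H = "\<lambda>x. complex_of_real (g x powr \<alpha>) * (u x * osc w x)"
    let ?R = "\<lambda>x. (of_real (\<alpha> * g x powr (\<alpha> - 1) * D g x) * u x + of_real (g x powr \<alpha>) * D u x) * osc w x"
    have split: "osc_integral w u = integral {0..\<delta>} ?F + integral {\<delta>..a} ?F"
      unfolding osc_integral_def using osc_integral_integrable[OF u, of 0 a w] a_pos \<delta>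
      by (intro Henstock_Kurzweil_Integration.integral_combine[symmetric]) auto
    have near: "cmod (integral {0..\<delta>} ?F) \<le> C0 / (\<alpha> + 1) * w powr (- (1 + \<alpha>))"
    proof -
      have I: "((\<lambda>x. C0 / (\<alpha> + 1) * ((\<alpha> + 1) * g x powr (\<alpha> + 1 - 1) * D g x)) has_integral
          C0 / (\<alpha> + 1) * (g \<delta> powr (\<alpha> + 1) - g 0 powr (\<alpha> + 1))) {0..\<delta>}"
        by (intro has_integral_mult_right g_powr_integral) (use \<delta> \<alpha>_gt in auto)
      have "cmod (integral {0..\<delta>} ?F) \<le> integral {0..\<delta>} (\<lambda>x. C0 / (\<alpha> + 1) * ((\<alpha> + 1) * g x powr (\<alpha> + 1 - 1) * D g x))"
      proof (rule Henstock_Kurzweil_Integration.integral_norm_bound_integral)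
        fix x assume x: "x \<in> {0..\<delta>}"
        have "cmod (?F x) = (g x powr \<alpha> * D g x) * cmod (u x)"
          using Dg_pos[of x] x \<delta> by (simp add: norm_mult)
        also have "\<dots> \<le> (g x powr \<alpha> * D g x) * C0"
          using C0(2)[of x] Dg_pos[of x] x \<delta> by (intro mult_left_mono) auto
        also have "\<dots> = C0 / (\<alpha> + 1) * ((\<alpha> + 1) * g x powr (\<alpha> + 1 - 1) * D g x)"
          using \<alpha>_gt by simp
        finally show "cmod (?F x) \<le> C0 / (\<alpha> + 1) * ((\<alpha> + 1) * g x powr (\<alpha> + 1 - 1) * D g x)" .
      qed (use osc_integral_integrable[OF u, of 0 \<delta> w] \<delta> I in \<open>auto dest: has_integral_integrable\<close>)
      also have "\<dots> = C0 / (\<alpha> + 1) * w powr (- (1 + \<alpha>))"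
        using integral_unique[OF I] g_0 g\<delta>[of "\<alpha> + 1"] by (simp add: add.commute)
      finally show ?thesis .
    qed
    have far: "w * cmod (integral {\<delta>..a} ?F) \<le> 2 * C0 * b powr \<alpha> + 2 * C0 * w powr (- \<alpha>) + K"
    proof -
      have "((\<lambda>x. ?R x + \<i> * of_real w * ?F x) has_integral ?H a - ?H \<delta>) {\<delta>..a}"
      proof (rule fundamental_theorem_of_calculus_interior)
        have c: "continuous_on {\<delta>..a} (\<lambda>x. u x * osc w x)"
          by (rule continuous_on_subset[OF smooth_continuous[OF smooth_mult[OF u smooth_osc]]]) (use \<delta> in auto)
        show "continuous_on {\<delta>..a} ?H"
          by (rule continuous_on_mult[OF continuous_on_of_real[OF continuous_g_powr] c])
            (use \<delta> \<delta>0 in simp_all)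
        fix x assume "x \<in> {\<delta><..<a}"
        then show "(?H has_vector_derivative ?R x + \<i> * of_real w * ?F x) (at x)"
          using boundary_deriv[OF u, of x \<alpha> w] \<delta> by simp
      qed (use \<delta> in auto)
      from has_integral_diff[OF this has_integral_mult_right[OF integrable_integral[OF osc_integral_integrable[OF u]], of \<delta> a "\<i> * of_real w" w]]
      have R: "(?R has_integral (?H a - ?H \<delta> - \<i> * of_real w * integral {\<delta>..a} ?F)) {\<delta>..a}"
        using \<delta> by simp
      \<comment> \<open>The sign of \<alpha> makes the first summand nonnegative; both summands are exact derivatives.\<close>
      let ?B = "\<lambda>x. C0 * sgn \<alpha> * (\<alpha> * g x powr (\<alpha> - 1) * D g x) + C1 / (\<alpha> + 1) * ((\<alpha> + 1) * g x powr (\<alpha> + 1 - 1) * D g x)"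
      have B: "(?B has_integral C0 * sgn \<alpha> * (b powr \<alpha> - g \<delta> powr \<alpha>) + C1 / (\<alpha> + 1) * (b powr (\<alpha> + 1) - g \<delta> powr (\<alpha> + 1))) {\<delta>..a}"
        unfolding b_def
        by (intro has_integral_add has_integral_mult_right g_powr_integral) (use \<delta> \<delta>0 in auto)
      have "cmod (integral {\<delta>..a} ?R) \<le> integral {\<delta>..a} ?B"
      proof (rule Henstock_Kurzweil_Integration.integral_norm_bound_integral)
        fix x assume x: "x \<in> {\<delta>..a}"
        have xa: "x \<in> {0..a}" using x \<delta> by simp
        have "cmod (?R x) = cmod (of_real (\<alpha> * g x powr (\<alpha> - 1) * D g x) * u x + of_real (g x powr \<alpha>) * D u x)"
          by (subst norm_mult) simp
        also have "\<dots> \<le> cmod (of_real (\<alpha> * g x powr (\<alpha> - 1) * D g x) * u x) + cmod (of_real (g x powr \<alpha>) * D u x)"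
          by (rule norm_triangle_ineq)
        also have "cmod (of_real (\<alpha> * g x powr (\<alpha> - 1) * D g x) * u x) = sgn \<alpha> * (\<alpha> * g x powr (\<alpha> - 1) * D g x) * cmod (u x)"
          using Dg_pos[OF xa] by (auto simp: norm_mult abs_mult sgn_if)
        also have "\<dots> \<le> sgn \<alpha> * (\<alpha> * g x powr (\<alpha> - 1) * D g x) * C0"
          using C0(2)[OF xa] Dg_pos[OF xa] \<alpha>_nz
          by (intro mult_left_mono) (auto simp: sgn_if mult_nonpos_nonneg)
        also have "cmod (of_real (g x powr \<alpha>) * D u x) \<le> g x powr \<alpha> * (C1 * D g x)"
          using Du[OF xa] by (simp add: norm_mult mult_left_mono)
        also have "sgn \<alpha> * (\<alpha> * g x powr (\<alpha> - 1) * D g x) * C0 + g x powr \<alpha> * (C1 * D g x) = ?B x"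
          using \<alpha>_gt by (simp add: mult_ac)
        finally show "cmod (?R x) \<le> ?B x" by simp
      qed (use R B in \<open>auto dest: has_integral_integrable\<close>)
      also have "\<dots> = C0 * (sgn \<alpha> * (b powr \<alpha> - g \<delta> powr \<alpha>)) + C1 / (\<alpha> + 1) * (b powr (\<alpha> + 1) - g \<delta> powr (\<alpha> + 1))"
        using integral_unique[OF B] by simp
      also have "\<dots> \<le> C0 * (b powr \<alpha> + g \<delta> powr \<alpha>) + C1 / (\<alpha> + 1) * b powr (\<alpha> + 1)"
        using C0 C1 \<alpha>_gt by (intro add_mono mult_left_mono) (auto simp: sgn_if)
      finally have R_le: "cmod (integral {\<delta>..a} ?R) \<le> C0 * (b powr \<alpha> + w powr (- \<alpha>)) + K"
        by (simp add: K_def g\<delta>)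
      have eq: "\<i> * of_real w * integral {\<delta>..a} ?F = ?H a - ?H \<delta> - integral {\<delta>..a} ?R"
        using integral_unique[OF R] by simp
      have "w * cmod (integral {\<delta>..a} ?F) = cmod (\<i> * of_real w * integral {\<delta>..a} ?F)"
        using w by (simp only: norm_mult norm_of_real) simp
      also have "\<dots> = cmod (?H a - ?H \<delta> - integral {\<delta>..a} ?R)"
        by (simp only: eq)
      also have "\<dots> \<le> cmod (?H a) + cmod (?H \<delta>) + cmod (integral {\<delta>..a} ?R)"
        by (intro order.trans[OF norm_triangle_ineq4] add_right_mono) auto
      also have "cmod (?H a) \<le> C0 * b powr \<alpha>"
        using C0(2)[of a] a_pos by (auto simp: norm_mult b_def mult.commute intro!: mult_right_mono)
      also have "cmod (?H \<delta>) \<le> C0 * w powr (- \<alpha>)"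
        using C0(2)[of \<delta>] \<delta>(1,2) by (auto simp: norm_mult g\<delta> mult.commute intro!: mult_right_mono)
      finally show ?thesis using R_le by (simp add: algebra_simps)
    qed
    have "cmod (osc_integral w u) \<le> cmod (integral {0..\<delta>} ?F) + cmod (integral {\<delta>..a} ?F)"
      unfolding split by (rule norm_triangle_ineq)
    also have "\<dots> \<le> C0 / (\<alpha> + 1) * w powr (- (1 + \<alpha>))
        + (2 * C0 * b powr \<alpha> + 2 * C0 * w powr (- \<alpha>) + K) / w"
      using w near far by (intro add_mono) (simp_all only: pos_le_divide_eq mult.commute)
    also have "\<dots> = C0 / (\<alpha> + 1) * w powr (- (1 + \<alpha>))
        + 2 * C0 * b powr \<alpha> * w powr (- 1) + 2 * C0 * w powr (- (1 + \<alpha>)) + K * w powr (- 1)"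
    proof -
      have "y / w = y * w powr (- 1)" for y
        using w by (simp add: powr_minus_divide)
      moreover have "w powr (- \<alpha>) * w powr (- 1) = w powr (- (1 + \<alpha>))"
        by (subst powr_add[symmetric]) (simp add: algebra_simps)
      ultimately show ?thesis by (simp only: distrib_right mult.assoc add.assoc)
    qed
    also have "\<dots> \<le> C0 / (\<alpha> + 1) * w powr (- min (1 + \<alpha>) 1)
        + 2 * C0 * b powr \<alpha> * w powr (- min (1 + \<alpha>) 1) + 2 * C0 * w powr (- min (1 + \<alpha>) 1) + K * w powr (- min (1 + \<alpha>) 1)"
      using w C0 K \<alpha>_gt by (intro add_mono mult_left_mono powr_mono) auto
    finally show ?thesis by (simp add: C_def algebra_simps)
  qed
  moreover have "C \<ge> 0" using C0 K \<alpha>_gt by (simp add: C_def)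
  ultimately show ?thesis
    by (intro exI[of _ C] conjI eventually_mono[OF eventually_ge_at_top[of "max 1 (1 / b)"]]) auto
qed

text \<open>The combination as a whole has to vanish at the endpoints for the integrations by parts to be
possible, but the resulting integral is estimated term by term. So the constant K depends on the
u_i and on the bound C only, and the coefficients d_i may vary with w.\<close>

lemma vanishing_combination_decay:
  assumes I: "finite I" and u: "\<And>i. i \<in> I \<Longrightarrow> smooth (u i)"
  shows "\<exists>K\<ge>0. \<forall>\<^sub>F w in at_top. \<forall>d. (\<forall>i\<in>I. cmod (d i) \<le> C) \<longrightarrow>
      vanishes k (\<lambda>x. \<Sum>i\<in>I. d i * u i x) 0 \<longrightarrow> vanishes k (\<lambda>x. \<Sum>i\<in>I. d i * u i x) a \<longrightarrow>
      cmod (osc_integral w (\<lambda>x. \<Sum>i\<in>I. d i * u i x)) \<le> K * w powr (- real k - min (1 + \<alpha>) 1)"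
proof -
  have "\<forall>i\<in>I. \<exists>B\<ge>0. \<forall>\<^sub>F w in at_top. cmod (osc_integral w ((ibp ^^ k) (u i))) \<le> B * w powr (- min (1 + \<alpha>) 1)"
    using osc_integral_decay[OF smooth_ibp_pow[OF u]] by blast
  then obtain B where B: "\<forall>i\<in>I. B i \<ge> 0 \<and>
      (\<forall>\<^sub>F w in at_top. cmod (osc_integral w ((ibp ^^ k) (u i))) \<le> B i * w powr (- min (1 + \<alpha>) 1))"
    by metis
  define K where "K = (\<Sum>i\<in>I. max C 0 * B i)"
  have "\<forall>\<^sub>F w in at_top. \<forall>i\<in>I. cmod (osc_integral w ((ibp ^^ k) (u i))) \<le> B i * w powr (- min (1 + \<alpha>) 1)"
    using B I by (intro eventually_ball_finite) auto
  then have "\<forall>\<^sub>F w in at_top. \<forall>d. (\<forall>i\<in>I. cmod (d i) \<le> C) \<longrightarrow>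
      vanishes k (\<lambda>x. \<Sum>i\<in>I. d i * u i x) 0 \<longrightarrow> vanishes k (\<lambda>x. \<Sum>i\<in>I. d i * u i x) a \<longrightarrow>
      cmod (osc_integral w (\<lambda>x. \<Sum>i\<in>I. d i * u i x)) \<le> K * w powr (- real k - min (1 + \<alpha>) 1)"
    using eventually_gt_at_top[of 0]
  proof (eventually_elim, intro allI impI)
    fix w :: real and d
    assume bound: "\<forall>i\<in>I. cmod (osc_integral w ((ibp ^^ k) (u i))) \<le> B i * w powr (- min (1 + \<alpha>) 1)" and w: "w > 0"
      and d: "\<forall>i\<in>I. cmod (d i) \<le> C"
      and van: "vanishes k (\<lambda>x. \<Sum>i\<in>I. d i * u i x) 0" "vanishes k (\<lambda>x. \<Sum>i\<in>I. d i * u i x) a"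
    let ?S = "\<lambda>x. \<Sum>i\<in>I. d i * u i x"
    have S: "smooth ?S" by (intro smooth_sum smooth_cmult u)
    have "w ^ k * cmod (osc_integral w ?S) = cmod ((\<i> * of_real w) ^ k * osc_integral w ?S)"
      using w by (simp add: norm_mult norm_power)
    also have "\<dots> = cmod (osc_integral w ((ibp ^^ k) ?S))"
      unfolding osc_integral_integration_by_parts_pow[OF S van] by (simp add: norm_mult norm_power)
    also have "osc_integral w ((ibp ^^ k) ?S) = osc_integral w (\<lambda>x. \<Sum>i\<in>I. d i * (ibp ^^ k) (u i) x)"
      by (rule osc_integral_cong[OF ibp_pow_lincomb[OF I u]])
    also have "\<dots> = (\<Sum>i\<in>I. d i * osc_integral w ((ibp ^^ k) (u i)))"
      by (rule osc_integral_lincomb[OF I smooth_ibp_pow[OF u]])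
    also have "cmod \<dots> \<le> (\<Sum>i\<in>I. max C 0 * (B i * w powr (- min (1 + \<alpha>) 1)))"
    proof (rule order.trans[OF norm_sum sum_mono])
      fix i assume i: "i \<in> I"
      show "cmod (d i * osc_integral w ((ibp ^^ k) (u i))) \<le> max C 0 * (B i * w powr (- min (1 + \<alpha>) 1))"
        unfolding norm_mult using bound d i by (intro mult_mono) (auto simp: le_max_iff_disj)
    qed
    also have "\<dots> = K * w powr (- min (1 + \<alpha>) 1)"
      by (simp add: K_def sum_distrib_right mult.assoc)
    finally have "cmod (osc_integral w ?S) \<le> K * w powr (- min (1 + \<alpha>) 1) / w ^ k"
      using w by (simp add: field_simps)
    also have "\<dots> = K * w powr (- real k - min (1 + \<alpha>) 1)"
      using w by (simp add: powr_diff powr_minus powr_realpow divide_inverse)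
    finally show "cmod (osc_integral w ?S) \<le> K * w powr (- real k - min (1 + \<alpha>) 1)" .
  qed
  moreover have "K \<ge> 0" using B by (auto simp: K_def intro!: sum_nonneg)
  ultimately show ?thesis by blast
qed

section \<open>The Levin antiderivative\<close>

lemma levin_op_eq:
  "levin_op a \<alpha> g w c0 q x = \<i> * of_real w * g'c x * c0 + gc x * D q x
     + (1 + of_real \<alpha> + \<i> * of_real w * gc x) * g'c x * q x"
  by (simp add: levin_op_def Let_def)

text \<open>The Levin antiderivative without its singular terms, see \<open>levin_antideriv_eq\<close>.\<close>

definition levin_primitive :: "real \<Rightarrow> complex \<Rightarrow> (real \<Rightarrow> complex) \<Rightarrow> real \<Rightarrow> complex" where
  "levin_primitive w c0 q x =
     of_real (g x powr (\<alpha> + 1)) * (q x * osc w x) + c0 * (\<i> * of_real w) * weighted_antideriv (osc w) x"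

lemma levin_primitive_0: "levin_primitive w c0 q 0 = 0"
  using weighted_antideriv(2)[OF smooth_osc] g_0 by (simp add: levin_primitive_def)

lemma continuous_levin_primitive:
  "continuous_on {0..a} (levin_primitive w c0 q)" if "smooth q"
  unfolding levin_primitive_def[abs_def]
  by (intro continuous_on_add continuous_on_mult_left continuous_g_powr_times[OF smooth_mult[OF that smooth_osc]]
      weighted_antideriv(1)[OF smooth_osc])

lemma levin_primitive_integral:
  assumes q: "smooth q"
  shows "((\<lambda>x. of_real (g x powr \<alpha>) * (levin_op a \<alpha> g w c0 q x * osc w x)) has_integral
    levin_primitive w c0 q a) {0..a}"
proof -
  have "((\<lambda>x. of_real (g x powr \<alpha>) * (levin_op a \<alpha> g w c0 q x * osc w x)) has_integral
    levin_primitive w c0 q a - levin_primitive w c0 q 0) {0..a}"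
  proof (rule fundamental_theorem_of_calculus_interior)
    fix x assume "x \<in> {0<..<a}"
    then have x: "0 < x" "x < a" by auto
    have "g x powr (\<alpha> + 1) = g x powr \<alpha> * g x"
      using g_pos[of x] x by (simp add: powr_add)
    then show "(levin_primitive w c0 q has_vector_derivative
        of_real (g x powr \<alpha>) * (levin_op a \<alpha> g w c0 q x * osc w x)) (at x)"
      unfolding levin_primitive_def[abs_def]
      by (intro has_vector_derivative_eq_rhs[OF has_vector_derivative_add[OF boundary_deriv[OF q x]
            has_vector_derivative_mult_right[OF weighted_antideriv(3)[OF smooth_osc x]]]])
        (simp add: levin_op_eq algebra_simps)
  qed (use a_pos continuous_levin_primitive[OF q] in auto)
  then show ?thesis by (simp add: levin_primitive_0)
qed

text \<open>By parts, \<alpha> \<integral>_0^x g^(\<alpha>-1) g' (1 - e^(iwg)) = g^\<alpha> (1 - e^(iwg)) + iw \<integral>_0^x g^\<alpha> g' e^(iwg). The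
boundary term is continuous at 0 because 1 - e^(iwg) is divisible by g.\<close>

lemma levin_h_integral:
  assumes x: "0 < x" "x \<le> a"
  shows "((\<lambda>t. of_real (nderiv {0..a} 1 g t) * (1 - osc w t) / of_real (g t powr (1 - \<alpha>))) has_integral
     (of_real (g x powr \<alpha>) * (1 - osc w x) + \<i> * of_real w * weighted_antideriv (osc w) x) / of_real \<alpha>) {0..x}"
proof -
  let ?K = "\<lambda>x. (of_real (g x powr \<alpha>) * (1 - osc w x) + \<i> * of_real w * weighted_antideriv (osc w) x) / of_real \<alpha>"
  let ?k = "\<lambda>t. of_real (nderiv {0..a} 1 g t) * (1 - osc w t) / of_real (g t powr (1 - \<alpha>))"
  have eq: "complex_of_real (g t powr \<alpha>) * (1 - osc w t) = - (of_real (g t powr (\<alpha> + 1)) * quot (osc w) t)"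
    if "t \<in> {0..a}" for t
    using quot_eq[OF that, of "osc w"] g_0 g_nonneg[OF that] g_eq_0_iff[OF that]
    by (cases "t = 0") (auto simp: powr_add)
  have "(?k has_integral ?K x - ?K 0) {0..x}"
  proof (rule fundamental_theorem_of_calculus_interior)
    have "continuous_on {0..a} (\<lambda>t. - (complex_of_real (g t powr (\<alpha> + 1)) * quot (osc w) t))"
      by (intro continuous_on_minus continuous_g_powr_times smooth_quot smooth_osc)
    then have "continuous_on {0..a} (\<lambda>t. complex_of_real (g t powr \<alpha>) * (1 - osc w t))"
      by (rule iffD2[OF continuous_on_cong[OF refl eq], rotated])
    then have "continuous_on {0..a} ?K"
      using \<alpha>_nz
      by (intro continuous_on_add continuous_on_divide continuous_on_mult_left continuous_on_const
          weighted_antideriv(1)[OF smooth_osc]) auto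
    then show "continuous_on {0..x} ?K"
      by (rule continuous_on_subset) (use x in auto)
    fix t assume "t \<in> {0<..<x}"
    then have t: "0 < t" "t < a" using x by auto
    have "((\<lambda>x. of_real (g x powr \<alpha>) * (1 - osc w x)) has_vector_derivative
       of_real (g t powr \<alpha>) * (0 - \<i> * of_real w * g'c t * osc w t)
       + of_real (\<alpha> * g t powr (\<alpha> - 1) * D g t) * (1 - osc w t)) (at t)"
      by (intro has_vector_derivative_mult has_vector_derivative_of_real g_powr_deriv t
          has_vector_derivative_diff has_vector_derivative_const osc_deriv_at)
    from has_vector_derivative_divide[OF has_vector_derivative_add[OF this
          has_vector_derivative_mult_right[OF weighted_antideriv(3)[OF smooth_osc t]]]]
    have "(?K has_vector_derivative
       (of_real (g t powr \<alpha>) * (0 - \<i> * of_real w * g'c t * osc w t)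
       + of_real (\<alpha> * g t powr (\<alpha> - 1) * D g t) * (1 - osc w t)
       + \<i> * of_real w * (of_real (g t powr \<alpha> * D g t) * osc w t)) / of_real \<alpha>) (at t)" .
    moreover have "g t powr (\<alpha> - 1) = inverse (g t powr (1 - \<alpha>))"
      by (simp add: powr_minus[symmetric])
    moreover have cancel: "complex_of_real \<alpha> * (inverse (of_real \<alpha>) * z) = z" for z
      using \<alpha>_nz by simp
    ultimately show "(?K has_vector_derivative ?k t) (at t)"
      by (elim has_vector_derivative_eq_rhs) (simp add: cancel divide_inverse algebra_simps)
  qed (use x in auto)
  moreover have "?K 0 = 0"
    using g_0 weighted_antideriv(2)[OF smooth_osc] by simp
  ultimately show ?thesis by simp
qed

text \<open>The boundary term of \<open>levin_h_integral\<close> cancels the term c_0 (1 - e^(-iwg)) g^\<alpha>.\<close>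

lemma levin_antideriv_eq:
  assumes x: "0 < x" "x \<le> a"
  shows "levin_antideriv a \<alpha> g w c0 q x = levin_primitive w c0 q x"
proof -
  define E where "E = exp (- \<i> * of_real w * gc x)"
  have E: "E * osc w x = 1" by (simp add: E_def mult_exp_exp)
  define P where "P = \<i> * of_real w * weighted_antideriv (osc w) x"
  have h: "levin_h a \<alpha> g w c0 x = c0 * E * (of_real (g x powr \<alpha>) * (1 - osc w x) + P)"
    unfolding levin_h_def integral_unique[OF levin_h_integral[OF x]] E_def P_def using \<alpha>_nz by simp
  have "levin_antideriv a \<alpha> g w c0 q x =
     of_real (g x powr (\<alpha> + 1)) * (q x * osc w x)
     + c0 * of_real (g x powr \<alpha>) * (osc w x - E * osc w x)
     + c0 * (E * osc w x) * (of_real (g x powr \<alpha>) * (1 - osc w x) + P)"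
    unfolding levin_antideriv_def h E_def[symmetric] by (simp add: algebra_simps)
  also have "\<dots> = levin_primitive w c0 q x"
    unfolding E levin_primitive_def P_def by (simp add: algebra_simps)
  finally show ?thesis .
qed

lemma levin_antideriv_limit:
  assumes q: "smooth q"
  shows "Lim (at_right 0) (levin_antideriv a \<alpha> g w c0 q) = 0"
proof (rule tendsto_Lim)
  have "(levin_primitive w c0 q \<longlongrightarrow> levin_primitive w c0 q 0) (at 0 within {0..a})"
    using continuous_levin_primitive[OF q] a_pos by (auto simp: continuous_on_def)
  then have "(levin_primitive w c0 q \<longlongrightarrow> 0) (at_right 0)"
    using a_pos by (simp add: levin_primitive_0 at_within_Icc_at_right)
  moreover have "\<forall>\<^sub>F x in at_right 0. levin_primitive w c0 q x = levin_antideriv a \<alpha> g w c0 q x"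
    using eventually_at_right_real[OF a_pos] by eventually_elim (simp add: levin_antideriv_eq)
  ultimately show "(levin_antideriv a \<alpha> g w c0 q \<longlongrightarrow> 0) (at_right 0)"
    using tendsto_cong by force
qed simp

lemma levin_Q_eq_osc_integral:
  assumes c: "levin_coeffs a \<alpha> f g n x m M \<phi> w = c" and q: "smooth (lin_comb M \<phi> c)"
  shows "levin_Q a \<alpha> f g n x m M \<phi> w = osc_integral w (\<lambda>t. levin_op a \<alpha> g w (c 0) (lin_comb M \<phi> c) t / g'c t)"
proof -
  have "levin_Q a \<alpha> f g n x m M \<phi> w = levin_primitive w (c 0) (lin_comb M \<phi> c) a"
    using a_pos by (simp add: levin_Q_def c levin_antideriv_limit[OF q] levin_antideriv_eq)
  also have "\<dots> = integral {0..a} (\<lambda>t. of_real (g t powr \<alpha>) *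
      (levin_op a \<alpha> g w (c 0) (lin_comb M \<phi> c) t * osc w t))"
    by (rule integral_unique[OF levin_primitive_integral[OF q], symmetric])
  also have "\<dots> = osc_integral w (\<lambda>t. levin_op a \<alpha> g w (c 0) (lin_comb M \<phi> c) t / g'c t)"
    unfolding osc_integral_def by (intro integral_cong) (use g'c_nz in \<open>simp add: field_simps\<close>)
  finally show ?thesis .
qed

text \<open>In terms of the slope \<gamma> = g(x)/x the function is f \<gamma>^(-\<alpha>), also at 0.\<close>

lemma smooth_f1:
  assumes f: "smooth f"
  shows "smooth (f1 a \<alpha> f g)"
proof -
  obtain \<gamma> where \<gamma>: "smooth \<gamma>" "\<forall>x\<in>{0..a}. g x = x * \<gamma> x \<and> \<gamma> x > 0" "\<gamma> 0 = D g 0"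
    using slope by blast
  have "f1 a \<alpha> f g x = f x * of_real (\<gamma> x powr (- \<alpha>))" if x: "x \<in> {0..a}" for x
  proof (cases "x = 0")
    case True
    then show ?thesis using \<gamma>(3) by (simp add: f1_def powr_minus divide_inverse)
  next
    case False
    then have "x / g x = inverse (\<gamma> x)"
      using bspec[OF \<gamma>(2) x] by (simp add: field_simps)
    then show ?thesis
      using bspec[OF \<gamma>(2) x] False by (simp add: f1_def powr_minus inverse_powr)
  qed
  moreover have "smooth (\<lambda>x. f x * of_real (\<gamma> x powr (- \<alpha>)))"
    using \<gamma>(2) by (intro smooth_mult f smooth_of_real(1) smooth_powr \<gamma>(1)) auto
  ultimately show ?thesis
    using smooth_cong[of "f1 a \<alpha> f g" "\<lambda>x. f x * of_real (\<gamma> x powr (- \<alpha>))"] by simp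
qed

lemma integral_eq_osc_integral_f1:
  "integral {0..a} (\<lambda>t. f t * of_real (t powr \<alpha>) * osc w t) = osc_integral w (\<lambda>t. f1 a \<alpha> f g t / g'c t)"
  unfolding osc_integral_def
proof (intro integral_cong)
  fix t assume t: "t \<in> {0..a}"
  have "f t * of_real (t powr \<alpha>) = f1 a \<alpha> f g t * of_real (g t powr \<alpha>)"
  proof (cases "t = 0")
    case False
    then show ?thesis using t g_pos[of t] by (simp add: f1_def powr_divide)
  qed (simp add: g_0)
  then show "f t * of_real (t powr \<alpha>) * osc w t
      = of_real (g t powr \<alpha> * D g t) * (f1 a \<alpha> f g t / g'c t * osc w t)"
    using g'c_nz[OF t] by simp
qed

end

section \<open>The collocation system\<close>

locale levin_collocation = phase +
  fixes f :: "real \<Rightarrow> complex" and n s M :: nat and x :: "nat \<Rightarrow> real" and m :: "nat \<Rightarrow> nat"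
    and \<phi> :: "nat \<Rightarrow> real \<Rightarrow> complex"
  assumes f_smooth: "smooth f"
    and x_0: "x 0 = 0" and x_n: "x n = a" and x_mono: "strict_mono_on {0..n} x"
    and m_0: "m 0 = s + 1" and m_n: "m n = s + 1"
    and M_def: "M = (\<Sum>l=0..n. m l) - 1"
    and \<phi>_smooth: "\<And>j. j \<in> {1..M} \<Longrightarrow> smooth (\<phi> j)"
    and chebyshev: "chebyshev_set {0..a} M \<phi>"
begin

lemma sum_m: "(\<Sum>l=0..n. m l) = M + 1"
proof -
  have "m 0 \<le> (\<Sum>l=0..n. m l)" by (rule member_le_sum) auto
  then show ?thesis using M_def m_0 by simp
qed

lemma x_in: "x l \<in> {0..a}" if "l \<le> n"
proof -
  have "x 0 \<le> x l" "x l \<le> x n"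
    using strict_mono_on_leD[OF x_mono, of 0 l] strict_mono_on_leD[OF x_mono, of l n] that by auto
  then show ?thesis by (simp add: x_0 x_n)
qed

lemma x_pos: "x l > 0" if "l \<le> n" "l > 0"
  using strict_mono_onD[OF x_mono, of 0 l] that x_0 by simp

lemma smooth_lin_comb: "smooth (lin_comb M \<phi> c)"
  unfolding lin_comb_def[abs_def] by (intro smooth_sum smooth_cmult \<phi>_smooth)

text \<open>The Levin operator applied to (c_0, q_1) is \<Sum>_k c_k (w B_k + E_k) with functions B_k (\<open>leading\<close>) and
E_k (\<open>remainder\<close>) that do not depend on w; the index 0 belongs to the unknown c_0.\<close>

definition leading :: "nat \<Rightarrow> real \<Rightarrow> complex" where
  "leading k t = \<i> * g'c t * (if k = 0 then 1 else gc t * \<phi> k t)"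

definition remainder :: "nat \<Rightarrow> real \<Rightarrow> complex" where
  "remainder k t = (if k = 0 then 0 else gc t * D (\<phi> k) t + (1 + of_real \<alpha>) * g'c t * \<phi> k t)"

lemma smooth_leading: "smooth (leading k)" if "k \<in> {0..M}"
proof (cases "k = 0")
  case False
  then show ?thesis
    unfolding leading_def[abs_def] using that
    by (simp, intro smooth_mult smooth_const smooth_g'c smooth_gc \<phi>_smooth) auto
next
  case True
  then show ?thesis
    unfolding leading_def[abs_def] by (simp, intro smooth_mult smooth_const smooth_g'c)
qed

lemma smooth_remainder: "smooth (remainder k)" if "k \<in> {0..M}"
proof (cases "k = 0")
  case False
  then show ?thesis
    unfolding remainder_def[abs_def] using that
    by (simp, intro smooth_add smooth_mult smooth_const smooth_g'c smooth_gc smooth_D \<phi>_smooth) auto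
qed (simp add: remainder_def[abs_def])

lemma sum_leading:
  "(\<Sum>k=0..M. c k * leading k t) = \<i> * g'c t * (c 0 + gc t * lin_comb M \<phi> c t)"
  by (simp add: sum.atLeast_Suc_atMost leading_def lin_comb_def sum_distrib_left algebra_simps)

lemma D_lin_comb: "D (lin_comb M \<phi> c) t = (\<Sum>k=1..M. c k * D (\<phi> k) t)" if t: "t \<in> {0..a}"
proof -
  have "D (lin_comb M \<phi> c) t = (\<Sum>k=1..M. D (\<lambda>t. c k * \<phi> k t) t)"
    unfolding lin_comb_def[abs_def]
    using nderiv_sum[of "{1..M}" "\<lambda>k t. c k * \<phi> k t" t 1] t \<phi>_smooth by (simp add: smooth_cmult)
  also have "\<dots> = (\<Sum>k=1..M. c k * D (\<phi> k) t)"
    using nderiv_cmult[OF \<phi>_smooth t, of _ 1] by (intro sum.cong) auto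
  finally show ?thesis .
qed

lemma levin_op_expansion:
  assumes t: "t \<in> {0..a}"
  shows "levin_op a \<alpha> g w (c 0) (lin_comb M \<phi> c) t =
    (\<Sum>k=0..M. c k * (of_real w * leading k t + remainder k t))"
proof -
  have "(\<Sum>k=0..M. c k * remainder k t) =
      gc t * D (lin_comb M \<phi> c) t + (1 + of_real \<alpha>) * g'c t * lin_comb M \<phi> c t"
    unfolding D_lin_comb[OF t]
    by (simp add: sum.atLeast_Suc_atMost remainder_def lin_comb_def sum_distrib_left sum.distrib algebra_simps)
  moreover have "(\<Sum>k=0..M. c k * (of_real w * leading k t + remainder k t)) =
     of_real w * (\<Sum>k=0..M. c k * leading k t) + (\<Sum>k=0..M. c k * remainder k t)"
    by (simp add: sum_distrib_left sum.distrib algebra_simps)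
  ultimately show ?thesis
    unfolding sum_leading levin_op_eq by (simp add: algebra_simps)
qed

text \<open>Nodes with \<mu>_l = 0 need not be zeros, so the multiplicities are summed over the other nodes only.\<close>

lemma chebyshev_zero_count:
  assumes van: "\<And>l. l \<le> n \<Longrightarrow> vanishes (\<mu> l) (lin_comb M \<phi> c) (x l)"
    and \<mu>: "(\<Sum>l=0..n. \<mu> l) = M" and k: "k \<in> {1..M}"
  shows "c k = 0"
proof (rule ccontr)
  assume nz: "c k \<noteq> 0"
  define q where "q = lin_comb M \<phi> c"
  define Z where "Z = {t\<in>{0..a}. q t = 0}"
  define L where "L = {l\<in>{0..n}. \<mu> l \<noteq> 0}"
  have "\<exists>j\<in>{1..M}. c j \<noteq> 0" using nz k by blast
  then have Z: "finite Z" "(\<Sum>t\<in>Z. zero_mult {0..a} q t) \<le> enat (M - 1)"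
    using chebyshev unfolding chebyshev_set_def Let_def Z_def q_def by blast+
  have inj: "inj_on x L"
    using strict_mono_on_imp_inj_on[OF x_mono] by (rule inj_on_subset) (auto simp: L_def)
  have sub: "x ` L \<subseteq> Z"
  proof
    fix t assume "t \<in> x ` L"
    then obtain l where l: "l \<le> n" "\<mu> l \<noteq> 0" "t = x l" by (auto simp: L_def)
    then obtain i where "\<mu> l = Suc i" by (cases "\<mu> l") auto
    then show "t \<in> Z"
      using van[OF l(1)] x_in[OF l(1)] l by (simp add: Z_def q_def vanishes_Suc)
  qed
  have "M = (\<Sum>l\<in>L. \<mu> l)"
    unfolding \<mu>[symmetric] L_def by (rule sum.mono_neutral_right) auto
  then have "enat M = (\<Sum>l\<in>L. enat (\<mu> l))"
    by (simp add: of_nat_eq_enat[symmetric])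
  also have "\<dots> \<le> (\<Sum>l\<in>L. zero_mult {0..a} q (x l))"
  proof (rule sum_mono)
    fix l assume "l \<in> L"
    then have "\<forall>j<\<mu> l. nderiv {0..a} j q (x l) = 0"
      using van[of l] by (simp add: L_def vanishes_def q_def)
    then show "enat (\<mu> l) \<le> zero_mult {0..a} q (x l)"
      unfolding zero_mult_def by (intro Sup_upper) auto
  qed
  also have "\<dots> = (\<Sum>t\<in>x ` L. zero_mult {0..a} q t)"
    by (simp add: sum.reindex[OF inj])
  also have "\<dots> \<le> (\<Sum>t\<in>Z. zero_mult {0..a} q t)"
    by (rule sum_mono2[OF Z(1) sub]) simp
  also have "\<dots> \<le> enat (M - 1)" by (rule Z(2))
  finally show False using k by simp
qed

text \<open>The sum is i g' (c_0 + g q). Its zero at 0 forces c_0 = 0; then division by g costs one zero at the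
node 0 and none elsewhere, and q is left with \<Sum>_l m_l - 1 = M zeros.\<close>

lemma limit_system_injective:
  assumes van: "\<And>l. l \<le> n \<Longrightarrow> vanishes (m l) (\<lambda>t. \<Sum>k=0..M. c k * leading k t) (x l)"
    and k: "k \<le> M"
  shows "c k = 0"
proof -
  let ?q = "lin_comb M \<phi> c"
  have q: "smooth ?q" by (rule smooth_lin_comb)
  have sgq: "smooth (\<lambda>t. gc t * ?q t)" by (intro smooth_mult smooth_gc q)
  have scq: "smooth (\<lambda>t. c 0 + gc t * ?q t)" by (intro smooth_add smooth_const sgq)
  have sg': "smooth (\<lambda>t. \<i> * g'c t)" by (intro smooth_cmult smooth_g'c)
  have v1: "vanishes (m l) (\<lambda>t. c 0 + gc t * ?q t) (x l)" if l: "l \<le> n" for l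
    using van[OF l] unfolding sum_leading
    by (rule vanishes_cancel_nonzero_factor[OF _ _ scq sg' x_in[OF l]]) (use g'c_nz[OF x_in[OF l]] in simp)
  have "c 0 = 0"
    using v1[of 0] m_0 x_0 g_0 by (simp add: vanishes_Suc)
  then have v2: "vanishes (m l) (\<lambda>t. gc t * ?q t) (x l)" if "l \<le> n" for l
    using v1[OF that] by simp
  obtain \<gamma> where \<gamma>: "smooth \<gamma>" "\<forall>x\<in>{0..a}. g x = x * \<gamma> x \<and> \<gamma> x > 0"
    using slope by blast
  have s\<gamma>: "smooth (\<lambda>t. complex_of_real (\<gamma> t))" by (rule smooth_of_real(1)[OF \<gamma>(1)])
  have eq: "gc t * ?q t = of_real t * (of_real (\<gamma> t) * ?q t)" if "t \<in> {0..a}" for t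
    using bspec[OF \<gamma>(2) that] by simp
  have 0: "0 \<in> {0..a}" using a_pos by simp
  have "vanishes (Suc s) (\<lambda>t. of_real t * (of_real (\<gamma> t) * ?q t)) 0"
    using v2[of 0] m_0 x_0
      vanishes_cong[of "\<lambda>t. gc t * ?q t" "\<lambda>t. of_real t * (of_real (\<gamma> t) * ?q t)", OF eq 0] by simp
  then have "vanishes s (\<lambda>t. of_real (\<gamma> t) * ?q t) 0"
    by (rule vanishes_cancel_ident) (intro smooth_mult s\<gamma> q)
  then have v0: "vanishes s ?q 0"
    by (rule vanishes_cancel_nonzero_factor[OF _ _ q s\<gamma> 0]) (use bspec[OF \<gamma>(2) 0] in simp)
  \<comment> \<open>m_0 = s + 1 is lowered to s, the other multiplicities are unchanged\<close>
  have v3: "vanishes ((m(0 := s)) l) ?q (x l)" if l: "l \<le> n" for l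
  proof (cases "l = 0")
    case True
    then show ?thesis using v0 x_0 by simp
  next
    case False
    then have "g (x l) > 0" using g_pos[of "x l"] x_pos[OF l] x_in[OF l] by simp
    then have "vanishes (m l) ?q (x l)"
      by (intro vanishes_cancel_nonzero_factor[OF v2[OF l] _ q smooth_gc x_in[OF l]]) simp
    then show ?thesis using False by simp
  qed
  have "(\<Sum>l=0..n. (m(0 := s)) l) = s + (\<Sum>l=1..n. m l)"
    by (simp add: sum.atLeast_Suc_atMost)
  also have "\<dots> = M"
    using sum_m m_0 by (simp add: sum.atLeast_Suc_atMost)
  finally have "c k = 0" if "k \<in> {1..M}" for k
    using chebyshev_zero_count[of "m(0 := s)" c k] v3 that by blast
  with \<open>c 0 = 0\<close> show ?thesis using k by (cases "k = 0") auto
qed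

lemma nderiv_levin_op:
  assumes t: "t \<in> {0..a}"
  shows "nderiv {0..a} j (levin_op a \<alpha> g w (c 0) (lin_comb M \<phi> c)) t =
    (\<Sum>k=0..M. (of_real w * nderiv {0..a} j (leading k) t + nderiv {0..a} j (remainder k) t) * c k)"
proof -
  have sm: "smooth (\<lambda>t. of_real w * leading k t + remainder k t)" if "k \<in> {0..M}" for k
    using that by (intro smooth_add smooth_cmult smooth_leading smooth_remainder)
  have "nderiv {0..a} j (levin_op a \<alpha> g w (c 0) (lin_comb M \<phi> c)) t =
     nderiv {0..a} j (\<lambda>t. \<Sum>k=0..M. c k * (of_real w * leading k t + remainder k t)) t"
    by (rule nderiv_cong[OF levin_op_expansion t])
  also have "\<dots> = (\<Sum>k=0..M. nderiv {0..a} j (\<lambda>t. c k * (of_real w * leading k t + remainder k t)) t)"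
    by (intro nderiv_sum finite_atLeastAtMost smooth_cmult sm t)
  also have "\<dots> = (\<Sum>k=0..M. (of_real w * nderiv {0..a} j (leading k) t + nderiv {0..a} j (remainder k) t) * c k)"
  proof (rule sum.cong[OF refl])
    fix k assume k: "k \<in> {0..M}"
    show "nderiv {0..a} j (\<lambda>t. c k * (of_real w * leading k t + remainder k t)) t
      = (of_real w * nderiv {0..a} j (leading k) t + nderiv {0..a} j (remainder k) t) * c k"
      unfolding nderiv_cmult[OF sm[OF k] t]
        nderiv_add[OF smooth_cmult[OF smooth_leading[OF k]] smooth_remainder[OF k] t]
        nderiv_cmult[OF smooth_leading[OF k] t]
      by (rule mult.commute)
  qed
  finally show ?thesis .
qed

lemma nderiv_sum_leading:
  assumes t: "t \<in> {0..a}"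
  shows "nderiv {0..a} j (\<lambda>t. \<Sum>k=0..M. c k * leading k t) t = (\<Sum>k=0..M. nderiv {0..a} j (leading k) t * c k)"
proof -
  have "nderiv {0..a} j (\<lambda>t. \<Sum>k=0..M. c k * leading k t) t = (\<Sum>k=0..M. nderiv {0..a} j (\<lambda>t. c k * leading k t) t)"
    by (intro nderiv_sum finite_atLeastAtMost smooth_cmult smooth_leading t)
  also have "\<dots> = (\<Sum>k=0..M. nderiv {0..a} j (leading k) t * c k)"
    by (intro sum.cong refl) (simp add: nderiv_cmult[OF smooth_leading t])
  finally show ?thesis .
qed

text \<open>Enumerating the pairs (l,j) of node and derivative order turns the collocation conditions into M+1
equations for M+1 unknowns, whose matrix is affine in w.\<close>

lemma system_solvable:
  "\<exists>C\<ge>0. \<forall>\<^sub>F w in at_top. (\<exists>!c. c \<in> {0..M} \<rightarrow>\<^sub>E UNIV \<and> levin_system a \<alpha> f g n x m M \<phi> w c) \<and>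
      (\<forall>c. levin_system a \<alpha> f g n x m M \<phi> w c \<longrightarrow> (\<forall>k\<le>M. cmod (of_real w * c k) \<le> C))"
proof -
  let ?E = "SIGMA l:{0..n}. {..<m l}"
  have "card ?E = M + 1" by (simp add: sum_m)
  then obtain e where e: "bij_betw e {0..<M + 1} ?E"
    using ex_bij_betw_nat_finite[of ?E] by auto
  define node where "node = (\<lambda>i. x (fst (e i)))"
  define ord where "ord = (\<lambda>i. snd (e i))"
  define sys where "sys = (\<lambda>w b (c :: nat \<Rightarrow> complex). \<forall>i<M + 1. (\<Sum>k<M + 1. (of_real w * nderiv {0..a} (ord i) (leading k) (node i)
      + nderiv {0..a} (ord i) (remainder k) (node i)) * c k) = b i)"
  define rhs where "rhs = (\<lambda>i. nderiv {0..a} (ord i) (f1 a \<alpha> f g) (node i))"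
  have all_eqs: "(\<forall>i<M + 1. P (node i) (ord i)) \<longleftrightarrow> (\<forall>l\<le>n. \<forall>j<m l. P (x l) j)" for P
  proof -
    have "(\<forall>i<M + 1. P (node i) (ord i)) \<longleftrightarrow> (\<forall>p\<in>e ` {0..<M + 1}. P (x (fst p)) (snd p))"
      by (auto simp: node_def ord_def)
    also have "e ` {0..<M + 1} = ?E" using e by (rule bij_betw_imp_surj_on)
    finally show ?thesis by auto
  qed
  have set: "{..<M + 1} = {0..M}" by auto
  have sys_iff: "levin_system a \<alpha> f g n x m M \<phi> w c \<longleftrightarrow> sys w rhs c" for w c
    unfolding sys_def rhs_def set
    unfolding all_eqs[of "\<lambda>t j. (\<Sum>k=0..M. (of_real w * nderiv {0..a} j (leading k) t
      + nderiv {0..a} j (remainder k) t) * c k) = nderiv {0..a} j (f1 a \<alpha> f g) t"] levin_system_def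
    using nderiv_levin_op[OF x_in] by simp
  have inj: "\<forall>c. (\<forall>i<M + 1. (\<Sum>k<M + 1. nderiv {0..a} (ord i) (leading k) (node i) * c k) = 0) \<longrightarrow> (\<forall>k<M + 1. c k = 0)"
  proof (intro allI impI)
    fix c k assume "\<forall>i<M + 1. (\<Sum>k<M + 1. nderiv {0..a} (ord i) (leading k) (node i) * c k) = 0"
    then have "\<forall>l\<le>n. \<forall>j<m l. (\<Sum>k=0..M. nderiv {0..a} j (leading k) (x l) * c k) = 0"
      unfolding set all_eqs[of "\<lambda>t j. (\<Sum>k=0..M. nderiv {0..a} j (leading k) t * c k) = 0"] .
    then have "\<And>l. l \<le> n \<Longrightarrow> vanishes (m l) (\<lambda>t. \<Sum>k=0..M. c k * leading k t) (x l)"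
      using nderiv_sum_leading[OF x_in] by (simp add: vanishes_def)
    moreover assume "k < M + 1"
    ultimately show "c k = 0" using limit_system_injective[of c k] by simp
  qed
  have "\<exists>C\<ge>0. \<forall>\<^sub>F w in at_top. (\<exists>c. sys w rhs c) \<and>
           (\<forall>c c'. sys w rhs c \<longrightarrow> sys w rhs c' \<longrightarrow> (\<forall>k<M + 1. c k = c' k)) \<and>
           (\<forall>c. sys w rhs c \<longrightarrow> (\<forall>k<M + 1. cmod (of_real w * c k) \<le> C))"
    unfolding sys_def by (rule square_system_with_large_parameter[OF inj])
  then obtain C where C: "C \<ge> 0" "\<forall>\<^sub>F w in at_top. (\<exists>c. sys w rhs c) \<and>
           (\<forall>c c'. sys w rhs c \<longrightarrow> sys w rhs c' \<longrightarrow> (\<forall>k<M + 1. c k = c' k)) \<and>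
           (\<forall>c. sys w rhs c \<longrightarrow> (\<forall>k<M + 1. cmod (of_real w * c k) \<le> C))"
    by (elim exE conjE)
  show ?thesis
  proof (intro exI conjI, rule C(1))
    show "\<forall>\<^sub>F w in at_top. (\<exists>!c. c \<in> {0..M} \<rightarrow>\<^sub>E UNIV \<and> levin_system a \<alpha> f g n x m M \<phi> w c) \<and>
      (\<forall>c. levin_system a \<alpha> f g n x m M \<phi> w c \<longrightarrow> (\<forall>k\<le>M. cmod (of_real w * c k) \<le> C))"
      using C(2)
    proof eventually_elim
      fix w
      assume S: "(\<exists>c. sys w rhs c) \<and>
           (\<forall>c c'. sys w rhs c \<longrightarrow> sys w rhs c' \<longrightarrow> (\<forall>k<M + 1. c k = c' k)) \<and>
           (\<forall>c. sys w rhs c \<longrightarrow> (\<forall>k<M + 1. cmod (of_real w * c k) \<le> C))"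
      then obtain c where c: "sys w rhs c" by blast
      have "sys w rhs (restrict c {0..M})"
        using c unfolding sys_def set by simp
      then have "restrict c {0..M} \<in> {0..M} \<rightarrow>\<^sub>E UNIV \<and> levin_system a \<alpha> f g n x m M \<phi> w (restrict c {0..M})"
        by (simp add: sys_iff)
      moreover have "c1 = c2"
        if "c1 \<in> {0..M} \<rightarrow>\<^sub>E UNIV \<and> levin_system a \<alpha> f g n x m M \<phi> w c1"
          "c2 \<in> {0..M} \<rightarrow>\<^sub>E UNIV \<and> levin_system a \<alpha> f g n x m M \<phi> w c2" for c1 c2
      proof -
        have "c1 k = c2 k" if "k < M + 1" for k
          using S that \<open>c1 \<in> _ \<and> _\<close> \<open>c2 \<in> _ \<and> _\<close> unfolding sys_iff by blast
        then show ?thesis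
          using that by (intro PiE_ext[of c1 "{0..M}" "\<lambda>_. UNIV" c2]) auto
      qed
      moreover have "\<forall>c. levin_system a \<alpha> f g n x m M \<phi> w c \<longrightarrow> (\<forall>k\<le>M. cmod (of_real w * c k) \<le> C)"
        using S unfolding sys_iff by (simp add: less_Suc_eq_le)
      ultimately show "(\<exists>!c. c \<in> {0..M} \<rightarrow>\<^sub>E UNIV \<and> levin_system a \<alpha> f g n x m M \<phi> w c) \<and>
          (\<forall>c. levin_system a \<alpha> f g n x m M \<phi> w c \<longrightarrow> (\<forall>k\<le>M. cmod (of_real w * c k) \<le> C))"
        by blast
    qed
  qed
qed

section \<open>The error of the Levin method\<close>

text \<open>The amplitude of the error as an oscillatory integral, hence the division by g'.\<close>

definition residual :: "real \<Rightarrow> (nat \<Rightarrow> complex) \<Rightarrow> real \<Rightarrow> complex" where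
  "residual w c t = (f1 a \<alpha> f g t - levin_op a \<alpha> g w (c 0) (lin_comb M \<phi> c) t) / g'c t"

lemma smooth_levin_op: "smooth (levin_op a \<alpha> g w (c 0) (lin_comb M \<phi> c))"
proof -
  have "smooth (\<lambda>t. \<Sum>k=0..M. c k * (of_real w * leading k t + remainder k t))"
    by (intro smooth_sum smooth_cmult smooth_add smooth_leading smooth_remainder)
  then show ?thesis
    using smooth_cong[of "levin_op a \<alpha> g w (c 0) (lin_comb M \<phi> c)", OF levin_op_expansion] by simp
qed

lemma vanishes_residual:
  assumes c: "levin_system a \<alpha> f g n x m M \<phi> w c" and l: "l \<le> n"
  shows "vanishes (m l) (residual w c) (x l)"
proof -
  let ?W = "levin_op a \<alpha> g w (c 0) (lin_comb M \<phi> c)"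
  have "vanishes (m l) (\<lambda>t. f1 a \<alpha> f g t + (- 1) * ?W t) (x l)"
    unfolding vanishes_def
    using c l by (simp only: nderiv_add[OF smooth_f1[OF f_smooth] smooth_cmult[OF smooth_levin_op] x_in[OF l]]
        nderiv_cmult[OF smooth_levin_op x_in[OF l]]) (simp add: levin_system_def)
  then have "vanishes (m l) (\<lambda>t. (f1 a \<alpha> f g t + (- 1) * ?W t) * inverse (g'c t)) (x l)"
    by (intro vanishes_mult smooth_add smooth_f1 f_smooth smooth_cmult smooth_levin_op smooth_inverse
        smooth_g'c g'c_nz x_in[OF l])
  then show ?thesis
    by (simp add: residual_def[abs_def] divide_inverse)
qed

lemma error_eq:
  assumes c: "levin_coeffs a \<alpha> f g n x m M \<phi> w = c"
  shows "integral {0..a} (\<lambda>t. f t * of_real (t powr \<alpha>) * osc w t) - levin_Q a \<alpha> f g n x m M \<phi> w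
    = osc_integral w (residual w c)"
proof -
  have "osc_integral w (residual w c) = osc_integral w (\<lambda>t. f1 a \<alpha> f g t / g'c t)
      - osc_integral w (\<lambda>t. levin_op a \<alpha> g w (c 0) (lin_comb M \<phi> c) t / g'c t)"
    unfolding osc_integral_def residual_def diff_divide_distrib left_diff_distrib right_diff_distrib
    using a_pos
    by (intro Henstock_Kurzweil_Integration.integral_diff osc_integral_integrable smooth_divide smooth_f1 f_smooth
        smooth_levin_op smooth_g'c g'c_nz) auto
  then show ?thesis
    unfolding integral_eq_osc_integral_f1 levin_Q_eq_osc_integral[OF c smooth_lin_comb] by simp
qed

text \<open>The three kinds of terms, B_k with coefficient -wc_k, E_k with coefficient -c_k and f_1 with
coefficient 1, are put into a single sum by tagging the index with 0, 1 or 2. All coefficients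
are bounded in w since c_k = O(1/w).\<close>

lemma residual_expansion:
  assumes t: "t \<in> {0..a}"
  shows "residual w c t = (\<Sum>p\<in>{0..M} \<times> {0, 1 :: nat} \<union> {(0, 2)}.
     (if snd p = 0 then - (of_real w * c (fst p)) else if snd p = 1 then - c (fst p) else 1) *
     ((if snd p = 0 then leading (fst p) t else if snd p = 1 then remainder (fst p) t else f1 a \<alpha> f g t) / g'c t))"
  (is "_ = (\<Sum>p\<in>_. ?F p)")
proof -
  have "(\<Sum>p\<in>{0..M} \<times> {0, 1 :: nat} \<union> {(0, 2)}. ?F p) = (\<Sum>p\<in>{0..M} \<times> {0, 1}. ?F p) + (\<Sum>p\<in>{(0, 2)}. ?F p)"
    by (rule sum.union_disjoint) auto
  also have "(\<Sum>p\<in>{0..M} \<times> {0, 1}. ?F p) = (\<Sum>k=0..M. \<Sum>j\<in>{0, 1}. ?F (k, j))"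
    unfolding sum.cartesian_product by (rule sum.cong[OF refl]) (simp add: case_prod_beta)
  also have "\<dots> = - (\<Sum>k=0..M. c k * (of_real w * leading k t + remainder k t)) / g'c t"
    unfolding sum_negf[symmetric] sum_divide_distrib
    by (intro sum.cong refl) (simp add: add_divide_distrib diff_divide_distrib algebra_simps)
  also have "(\<Sum>p\<in>{(0 :: nat, 2 :: nat)}. ?F p) = f1 a \<alpha> f g t / g'c t" by simp
  finally show ?thesis
    unfolding residual_def levin_op_expansion[OF t] by (simp add: diff_divide_distrib)
qed

lemma levin_error_bound:
  "(\<lambda>w. cmod (integral {0..a} (\<lambda>t. f t * of_real (t powr \<alpha>) * osc w t) - levin_Q a \<alpha> f g n x m M \<phi> w))
    \<in> O[at_top](\<lambda>w. w powr (- real s - 1 - min (1 + \<alpha>) 1))"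
proof -
  obtain C where C: "C \<ge> 0" "\<forall>\<^sub>F w in at_top. (\<exists>!c. c \<in> {0..M} \<rightarrow>\<^sub>E UNIV \<and> levin_system a \<alpha> f g n x m M \<phi> w c) \<and>
      (\<forall>c. levin_system a \<alpha> f g n x m M \<phi> w c \<longrightarrow> (\<forall>k\<le>M. cmod (of_real w * c k) \<le> C))"
    using system_solvable by blast
  define I where "I = {0..M} \<times> {0, 1 :: nat} \<union> {(0, 2)}"
  define u where "u = (\<lambda>p t. (if snd p = 0 then leading (fst p) t else
      if snd p = (1 :: nat) then remainder (fst p) t else f1 a \<alpha> f g t) / g'c t)"
  have "smooth (u p)" if "p \<in> I" for p
  proof -
    have "smooth (\<lambda>t. if snd p = 0 then leading (fst p) t else
      if snd p = (1 :: nat) then remainder (fst p) t else f1 a \<alpha> f g t)"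
      using that smooth_leading[of "fst p"] smooth_remainder[of "fst p"] smooth_f1[OF f_smooth]
      by (cases "snd p = 0"; cases "snd p = 1") (auto simp: I_def)
    then show ?thesis
      unfolding u_def by (intro smooth_divide smooth_g'c g'c_nz)
  qed
  from vanishing_combination_decay[of I u "max C 1" "s + 1", OF _ this]
  obtain K where K: "\<forall>\<^sub>F w in at_top. \<forall>d. (\<forall>i\<in>I. cmod (d i) \<le> max C 1) \<longrightarrow>
      vanishes (s + 1) (\<lambda>x. \<Sum>i\<in>I. d i * u i x) 0 \<longrightarrow> vanishes (s + 1) (\<lambda>x. \<Sum>i\<in>I. d i * u i x) a \<longrightarrow>
      cmod (osc_integral w (\<lambda>x. \<Sum>i\<in>I. d i * u i x)) \<le> K * w powr (- real (s + 1) - min (1 + \<alpha>) 1)"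
    by (auto simp: I_def)
  have "\<forall>\<^sub>F w in at_top. cmod (integral {0..a} (\<lambda>t. f t * of_real (t powr \<alpha>) * osc w t)
      - levin_Q a \<alpha> f g n x m M \<phi> w) \<le> K * w powr (- real s - 1 - min (1 + \<alpha>) 1)"
    using C(2) K eventually_ge_at_top[of 1]
  proof eventually_elim
    fix w :: real
    assume S: "(\<exists>!c. c \<in> {0..M} \<rightarrow>\<^sub>E UNIV \<and> levin_system a \<alpha> f g n x m M \<phi> w c) \<and>
      (\<forall>c. levin_system a \<alpha> f g n x m M \<phi> w c \<longrightarrow> (\<forall>k\<le>M. cmod (of_real w * c k) \<le> C))"
      and K: "\<forall>d. (\<forall>i\<in>I. cmod (d i) \<le> max C 1) \<longrightarrow>
      vanishes (s + 1) (\<lambda>x. \<Sum>i\<in>I. d i * u i x) 0 \<longrightarrow> vanishes (s + 1) (\<lambda>x. \<Sum>i\<in>I. d i * u i x) a \<longrightarrow>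
      cmod (osc_integral w (\<lambda>x. \<Sum>i\<in>I. d i * u i x)) \<le> K * w powr (- real (s + 1) - min (1 + \<alpha>) 1)"
      and w: "w \<ge> 1"
    define c where "c = levin_coeffs a \<alpha> f g n x m M \<phi> w"
    have sys: "levin_system a \<alpha> f g n x m M \<phi> w c"
      using theI'[OF conjunct1[OF S]] unfolding c_def levin_coeffs_def by (rule conjunct2)
    have wc: "cmod (of_real w * c k) \<le> C" if "k \<le> M" for k
      using S sys that by blast
    have cC: "cmod (c k) \<le> C" if "k \<le> M" for k
    proof -
      have "1 * cmod (c k) \<le> w * cmod (c k)" using w by (intro mult_right_mono) auto
      then show ?thesis using wc[OF that] w by (simp add: norm_mult)
    qed
    define d where "d = (\<lambda>p. if snd p = 0 then - (of_real w * c (fst p)) else if snd p = (1 :: nat) then - c (fst p) else 1)"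
    have eq: "residual w c t = (\<Sum>p\<in>I. d p * u p t)" if "t \<in> {0..a}" for t
      unfolding residual_expansion[OF that] I_def d_def u_def ..
    have ends: "0 \<in> {0..a}" "a \<in> {0..a}" using a_pos by auto
    have "vanishes (s + 1) (residual w c) 0" "vanishes (s + 1) (residual w c) a"
      using vanishes_residual[OF sys, of 0] vanishes_residual[OF sys, of n] by (auto simp: x_0 x_n m_0 m_n)
    then have "vanishes (s + 1) (\<lambda>t. \<Sum>p\<in>I. d p * u p t) 0" "vanishes (s + 1) (\<lambda>t. \<Sum>p\<in>I. d p * u p t) a"
      using vanishes_cong[of "residual w c" "\<lambda>t. \<Sum>p\<in>I. d p * u p t", OF eq] ends by blast+
    moreover have "\<forall>p\<in>I. cmod (d p) \<le> max C 1"
      using wc cC by (auto simp: I_def d_def le_max_iff_disj)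
    ultimately have "cmod (osc_integral w (\<lambda>t. \<Sum>p\<in>I. d p * u p t)) \<le> K * w powr (- real (s + 1) - min (1 + \<alpha>) 1)"
      using K by blast
    moreover have osc_integral_eq: "osc_integral w (residual w c) = osc_integral w (\<lambda>t. \<Sum>p\<in>I. d p * u p t)"
      by (rule osc_integral_cong) (rule eq)
    moreover have "- real (s + 1) - min (1 + \<alpha>) 1 = - real s - 1 - min (1 + \<alpha>) 1" by simp
    ultimately show "cmod (integral {0..a} (\<lambda>t. f t * of_real (t powr \<alpha>) * osc w t)
      - levin_Q a \<alpha> f g n x m M \<phi> w) \<le> K * w powr (- real s - 1 - min (1 + \<alpha>) 1)"
      unfolding error_eq[OF c_def[symmetric]] osc_integral_eq by (simp only:)
  qed
  then show ?thesis
    by (intro bigoI[of _ K]) simp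
qed

end

theorem theorem2p4:
  fixes a \<alpha> :: real and f :: "real \<Rightarrow> complex" and g :: "real \<Rightarrow> real"
    and n s M :: nat and x :: "nat \<Rightarrow> real" and m :: "nat \<Rightarrow> nat"
    and \<phi> :: "nat \<Rightarrow> real \<Rightarrow> complex"
  assumes "a > 0" and "0 < \<bar>\<alpha>\<bar>" and "\<bar>\<alpha>\<bar> < 1"
    and "smooth_within {0..a} f" and "smooth_within {0..a} g"
    and "g 0 = 0" and "\<And>t. t \<in> {0..a} \<Longrightarrow> nderiv {0..a} 1 g t > 0"
    and "x 0 = 0" and "x n = a" and "strict_mono_on {0..n} x"
    and "\<And>l. l \<le> n \<Longrightarrow> m l \<ge> 1" and "m 0 = s + 1" and "m n = s + 1"
    and "M = (\<Sum>l=0..n. m l) - 1"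
    and "\<And>j. j \<in> {1..M} \<Longrightarrow> smooth_within {0..a} (\<phi> j)"
    and "chebyshev_set {0..a} M \<phi>"
  shows "(\<forall>\<^sub>F w in at_top. \<exists>!c. c \<in> {0..M} \<rightarrow>\<^sub>E UNIV \<and> levin_system a \<alpha> f g n x m M \<phi> w c)
    \<and> (\<lambda>w. cmod (integral {0..a}
                  (\<lambda>t. f t * of_real (t powr \<alpha>) * exp (\<i> * of_real w * of_real (g t)))
                - levin_Q a \<alpha> f g n x m M \<phi> w))
      \<in> O[at_top](\<lambda>w::real. w powr (- real s - 1 - min (1 + \<alpha>) 1))"
proof -
  interpret initial_interval a
    by unfold_locales (rule assms(1))
  have Dg: "D g t > 0" if "t \<in> {0..a}" for t
    using assms(7)[OF that] by simp
  interpret levin_collocation a g \<alpha> f n s M x m \<phi>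
    by unfold_locales (use assms Dg in auto)
  show ?thesis
  proof
    obtain C where "\<forall>\<^sub>F w in at_top. (\<exists>!c. c \<in> {0..M} \<rightarrow>\<^sub>E UNIV \<and> levin_system a \<alpha> f g n x m M \<phi> w c) \<and>
      (\<forall>c. levin_system a \<alpha> f g n x m M \<phi> w c \<longrightarrow> (\<forall>k\<le>M. cmod (of_real w * c k) \<le> C))"
      using system_solvable by blast
    then show "\<forall>\<^sub>F w in at_top. \<exists>!c. c \<in> {0..M} \<rightarrow>\<^sub>E UNIV \<and> levin_system a \<alpha> f g n x m M \<phi> w c"
      by (rule eventually_mono) blast
  qed (rule levin_error_bound)
qed

end
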